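(* Let the $s$-stage implicit Peer method with coefficients $(c,P,Q,R)$, where $$Q=\big(CV_0-P(C-I)V_1-RV_0D\big)(V_1D)^{-1},$$ be zero-stable with stage order equal to $s$, let $S_2\in\mathbb R^{s\times s}$ be strictly lower triangular, $S_1=(I-S_2)V_0V_1^{-1}$, and let the IMEX-Peer method $$w_n=Pw_{n-1}+\Delta t\,\hat QF_0(w_{n-1})+\Delta t\,\hat RF_0(w_n)+\Delta t\,QF_1(w_{n-1})+\Delta t\,RF_1(w_n)$$ with $\hat R=RS_2$, $\hat Q=Q+RS_1$ and constant step size $\Delta t$ be convergent of order $s$. Put $$d_{s+1}=\frac{1}{(s+1)!}\Big(c^{s+1}-P(c-e)^{s+1}-(s+1)Q(c-e)^{s}-(s+1)Rc^{s}\Big),\qquad l_s=\frac1{s!}\Big((I-S_2)c^s-S_1(c-e)^s\Big).$$ If the initial values are of order $s+1$, i.e. $w_{0,i}-u(t_0+c_i\Delta t)=\mathcal O(\Delta t^{s+1})$ for $i=1,\dots,s$, and $d_{s+1}\in\mathrm{range}(I-P)$ and $R\,l_s\in\mathrm{range}(I-P)$, then the order of convergence of the IMEX-Peer method is $s+1$.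
   Context: Problem: $u'(t)=F_0(u(t))+F_1(u(t))$, $u(0)=u_0\in\mathbb V=\mathbb R^m$, with $F_0,F_1$ sufficiently smooth and $u$ a (smooth) solution on an open interval containing $[0,T]$, $T>0$ fixed. Coefficients: $P,Q,R$ are real $s\times s$ matrices, $R$ is lower triangular with constant diagonal $\gamma>0$; the nodes $c_i\in\mathbb R$ are pairwise distinct with $c_s=1$. The associated implicit Peer method for $u'=F(u)$ is $w_n=Pw_{n-1}+\Delta t\,QF(w_{n-1})+\Delta t\,RF(w_n)$. Here $t_n=n\Delta t$, $w_n=[w_{n,1},\dots,w_{n,s}]^T\in\mathbb V^s$ with $w_{n,i}\approx u(t_n+c_i\Delta t)$. An $s\times s$ matrix $A$ acts on $\mathbb V^s$ as $A\otimes I_m$, and $F_k(w)=[F_k(w_i)]_{i=1}^s$ for $w\in\mathbb V^s$. Notation: $V_0=(c_i^{j-1})_{i,j=1}^s$, $V_1=((c_i-1)^{j-1})_{i,j=1}^s$ (with zeroth powers equal to $1$), $C=\mathrm{diag}(c_1,\dots,c_s)$, $D=\mathrm{diag}(1,2,\dots,s)$, $e=(1,\dots,1)^T$, $c=(c_1,\dots,c_s)^T$; powers of vectors are componentwise; $d_j=\frac1{j!}\big(c^j-P(c-e)^j-jQ(c-e)^{j-1}-jRc^{j-1}\big)$. The implicit method has stage order $q$ if $Pe=e$ (pre-consistency) and $d_j=0$ for $j=1,\dots,q$. It is zero-stable if $P$ is power bounded. Convergence of order $p$: with $w(t_n)=[u(t_n+c_i\Delta t)]_{i=1}^s$, $\max_{0\le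 n\Delta t\le T}\|w(t_n)-w_n\|=\mathcal O(\Delta t^p)$ as $\Delta t\to0$, where the constant may depend on $F_0,F_1,u,T$ and the method. The numerical solution $w_n$ is understood, for $\Delta t$ sufficiently small and $n\Delta t\le T$, as a solution of the recursion that stays in a fixed bounded neighbourhood (independent of $\Delta t$) of the exact solution. *)

theory Defs
  imports
    "HOL-Analysis.Analysis"
    "HOL-Library.Landau_Symbols"
    "Jordan_Normal_Form.Gauss_Jordan_Elimination"
begin

unbundle no vec_syntax

text \<open>
  Matrices and coefficient vectors are those of \<open>Jordan_Normal_Form\<close>, with indices running from 0:
  the node \<open>c\<^sub>i\<close> is \<open>c $ (i - 1)\<close>, and the number of stages is \<open>dim_vec c\<close>.
  An element of \<open>V\<^sup>s\<close> is a function \<open>nat \<Rightarrow> 'v\<close> of which only the values at \<open>i < s\<close> matter.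
\<close>


subsection \<open>Smoothness\<close>

text \<open>
  For open \<open>S\<close>: \<open>f\<close> is \<open>k\<close> times continuously differentiable on \<open>S\<close>. The total derivative
  \<open>x \<mapsto> Df(x)\<close> is \<open>C\<^sup>k\<close> iff \<open>x \<mapsto> Df(x) v\<close> is for every \<open>v\<close>, as the domain is
  finite-dimensional.
\<close>

fun Ck_on :: "nat \<Rightarrow> ('a::euclidean_space \<Rightarrow> 'b::real_normed_vector) \<Rightarrow> 'a set \<Rightarrow> bool" where
  "Ck_on 0 f S \<longleftrightarrow> continuous_on S f"
| "Ck_on (Suc k) f S \<longleftrightarrow>
     (\<forall>x\<in>S. f differentiable (at x)) \<and> (\<forall>v. Ck_on k (\<lambda>x. frechet_derivative f (at x) v) S)"


subsection \<open>Coefficients of Peer methods\<close>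

definition ones :: "real Matrix.vec \<Rightarrow> real Matrix.vec" where
  "ones c = Matrix.vec (dim_vec c) (\<lambda>_. 1)"

definition vec_pow :: "real Matrix.vec \<Rightarrow> nat \<Rightarrow> real Matrix.vec" where
  "vec_pow c j = map_vec (\<lambda>x. x ^ j) c"

definition V0_mat :: "real Matrix.vec \<Rightarrow> real Matrix.mat" where
  "V0_mat c = Matrix.mat (dim_vec c) (dim_vec c) (\<lambda>(i, j). (c $ i) ^ j)"

definition V1_mat :: "real Matrix.vec \<Rightarrow> real Matrix.mat" where
  "V1_mat c = Matrix.mat (dim_vec c) (dim_vec c) (\<lambda>(i, j). (c $ i - 1) ^ j)"

definition C_mat :: "real Matrix.vec \<Rightarrow> real Matrix.mat" where
  "C_mat c = mat_diag (dim_vec c) (\<lambda>i. c $ i)"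

definition D_mat :: "real Matrix.vec \<Rightarrow> real Matrix.mat" where
  "D_mat c = mat_diag (dim_vec c) (\<lambda>i. real (i + 1))"

text \<open>The matrices inverted below are nonsingular when the nodes are pairwise distinct.\<close>

definition mat_inv :: "real Matrix.mat \<Rightarrow> real Matrix.mat" where
  "mat_inv A = the (mat_inverse A)"

definition peer_Q :: "real Matrix.vec \<Rightarrow> real Matrix.mat \<Rightarrow> real Matrix.mat \<Rightarrow> real Matrix.mat" where
  "peer_Q c P R =
     (C_mat c * V0_mat c - P * (C_mat c - 1\<^sub>m (dim_vec c)) * V1_mat c - R * V0_mat c * D_mat c)
       * mat_inv (V1_mat c * D_mat c)"

definition peer_S1 :: "real Matrix.vec \<Rightarrow> real Matrix.mat \<Rightarrow> real Matrix.mat" where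
  "peer_S1 c S2 = (1\<^sub>m (dim_vec c) - S2) * V0_mat c * mat_inv (V1_mat c)"

text \<open>The residual coefficient \<open>d\<^sub>j\<close>, meant for \<open>j \<ge> 1\<close>.\<close>

definition peer_d ::
  "real Matrix.vec \<Rightarrow> real Matrix.mat \<Rightarrow> real Matrix.mat \<Rightarrow> real Matrix.mat \<Rightarrow> nat \<Rightarrow> real Matrix.vec"
where
  "peer_d c P Q R j =
     (1 / fact j) \<cdot>\<^sub>v
       (vec_pow c j - P *\<^sub>v vec_pow (c - ones c) j
         - real j \<cdot>\<^sub>v (Q *\<^sub>v vec_pow (c - ones c) (j - 1))
         - real j \<cdot>\<^sub>v (R *\<^sub>v vec_pow c (j - 1)))"

definition peer_l ::
  "real Matrix.vec \<Rightarrow> real Matrix.mat \<Rightarrow> real Matrix.mat \<Rightarrow> nat \<Rightarrow> real Matrix.vec"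
where
  "peer_l c S1 S2 j =
     (1 / fact j) \<cdot>\<^sub>v
       ((1\<^sub>m (dim_vec c) - S2) *\<^sub>v vec_pow c j - S1 *\<^sub>v vec_pow (c - ones c) j)"

definition stage_order ::
  "real Matrix.vec \<Rightarrow> real Matrix.mat \<Rightarrow> real Matrix.mat \<Rightarrow> real Matrix.mat \<Rightarrow> nat \<Rightarrow> bool"
where
  "stage_order c P Q R q \<longleftrightarrow>
     P *\<^sub>v ones c = ones c \<and> (\<forall>j\<in>{1..q}. peer_d c P Q R j = 0\<^sub>v (dim_vec c))"

definition power_bounded :: "real Matrix.mat \<Rightarrow> bool" where
  "power_bounded P \<longleftrightarrow>
     (\<exists>K. \<forall>n. \<forall>i<dim_row P. \<forall>j<dim_col P. \<bar>(P ^\<^sub>m n) $$ (i, j)\<bar> \<le> K)"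

abbreviation zero_stable :: "real Matrix.mat \<Rightarrow> bool" where
  "zero_stable P \<equiv> power_bounded P"

definition mat_range :: "real Matrix.mat \<Rightarrow> real Matrix.vec set" where
  "mat_range A = (\<lambda>x. A *\<^sub>v x) ` carrier_vec (dim_col A)"

text \<open>Admissible coefficients \<open>(c,P,Q,R)\<close> of an \<open>s\<close>-stage implicit Peer method.\<close>

definition implicit_peer ::
  "nat \<Rightarrow> real Matrix.vec \<Rightarrow> real Matrix.mat \<Rightarrow> real Matrix.mat \<Rightarrow> real Matrix.mat \<Rightarrow> bool"
where
  "implicit_peer s c P Q R \<longleftrightarrow>
     s \<ge> 1 \<and> c \<in> carrier_vec s \<and>
     P \<in> carrier_mat s s \<and> Q \<in> carrier_mat s s \<and> R \<in> carrier_mat s s \<and>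
     (\<forall>i<s. \<forall>j<s. i \<noteq> j \<longrightarrow> c $ i \<noteq> c $ j) \<and> c $ (s - 1) = 1 \<and>
     (\<forall>i<s. \<forall>j<s. i < j \<longrightarrow> R $$ (i, j) = 0) \<and>
     (\<exists>\<gamma>>0. \<forall>i<s. R $$ (i, i) = \<gamma>)"

definition strictly_lower_triangular :: "real Matrix.mat \<Rightarrow> bool" where
  "strictly_lower_triangular A \<longleftrightarrow> (\<forall>i<dim_row A. \<forall>j<dim_col A. i \<le> j \<longrightarrow> A $$ (i, j) = 0)"


subsection \<open>The initial value problem, the IMEX-Peer method and convergence\<close>

definition ivp_solution ::
  "('v::real_normed_vector \<Rightarrow> 'v) \<Rightarrow> ('v \<Rightarrow> 'v) \<Rightarrow> 'v \<Rightarrow> real set \<Rightarrow> (real \<Rightarrow> 'v) \<Rightarrow> bool"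
where
  "ivp_solution F0 F1 u0 J u \<longleftrightarrow>
     (\<forall>t\<in>J. (u has_vector_derivative F0 (u t) + F1 (u t)) (at t)) \<and> u 0 = u0"

text \<open>The action of \<open>A \<otimes> I\<close> on \<open>V\<^sup>s\<close>.\<close>

definition mat_act :: "real Matrix.mat \<Rightarrow> (nat \<Rightarrow> 'v::real_vector) \<Rightarrow> nat \<Rightarrow> 'v" where
  "mat_act A w i = (\<Sum>j<dim_col A. (A $$ (i, j)) *\<^sub>R w j)"

text \<open>
  \<open>W h n i\<close> is the \<open>i\<close>-th stage at step \<open>n\<close> computed with step size \<open>h\<close>, where \<open>t\<^sub>n = n h\<close>. The
  stages are required to stay within a distance of the exact solution that is independent of \<open>h\<close>.
  The starting values \<open>W h 0 i\<close> are free. Nodes may lie outside \<open>{0..1}\<close>, but \<open>t\<^sub>n + c\<^sub>i h\<close> lies in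
  any given open neighbourhood of \<open>{0..T}\<close> once \<open>h\<close> is small.
\<close>

definition imex_peer_solution ::
  "real Matrix.vec \<Rightarrow> real Matrix.mat \<Rightarrow> real Matrix.mat \<Rightarrow> real Matrix.mat \<Rightarrow> real Matrix.mat \<Rightarrow>
   real Matrix.mat \<Rightarrow> ('v::real_normed_vector \<Rightarrow> 'v) \<Rightarrow> ('v \<Rightarrow> 'v) \<Rightarrow> (real \<Rightarrow> 'v) \<Rightarrow> real \<Rightarrow>
   (real \<Rightarrow> nat \<Rightarrow> nat \<Rightarrow> 'v) \<Rightarrow> bool"
where
  "imex_peer_solution c P Q R Qhat Rhat F0 F1 u T W \<longleftrightarrow>
     (\<forall>\<^sub>F h in at_right 0. \<forall>n\<ge>1. real n * h \<le> T \<longrightarrow> (\<forall>i<dim_vec c.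
        W h n i = mat_act P (W h (n - 1)) i
          + h *\<^sub>R mat_act Qhat (\<lambda>j. F0 (W h (n - 1) j)) i
          + h *\<^sub>R mat_act Rhat (\<lambda>j. F0 (W h n j)) i
          + h *\<^sub>R mat_act Q (\<lambda>j. F1 (W h (n - 1) j)) i
          + h *\<^sub>R mat_act R (\<lambda>j. F1 (W h n j)) i)) \<and>
     (\<exists>r. \<forall>\<^sub>F h in at_right 0. \<forall>n. real n * h \<le> T \<longrightarrow> (\<forall>i<dim_vec c.
        dist (W h n i) (u (real n * h + c $ i * h)) \<le> r))"

definition stage_norm :: "nat \<Rightarrow> (nat \<Rightarrow> 'v::real_normed_vector) \<Rightarrow> real" where
  "stage_norm s w = (MAX i\<in>{..<s}. norm (w i))"

definition global_error ::
  "real Matrix.vec \<Rightarrow> (real \<Rightarrow> 'v::real_normed_vector) \<Rightarrow> real \<Rightarrow> (real \<Rightarrow> nat \<Rightarrow> nat \<Rightarrow> 'v) \<Rightarrow> real \<Rightarrow> real"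
where
  "global_error c u T W h =
     (MAX n\<in>{n. real n * h \<le> T}.
        stage_norm (dim_vec c) (\<lambda>i. u (real n * h + c $ i * h) - W h n i))"

definition convergent_of_order ::
  "real Matrix.vec \<Rightarrow> (real \<Rightarrow> 'v::real_normed_vector) \<Rightarrow> real \<Rightarrow> (real \<Rightarrow> nat \<Rightarrow> nat \<Rightarrow> 'v) \<Rightarrow> nat \<Rightarrow> bool"
where
  "convergent_of_order c u T W p \<longleftrightarrow> global_error c u T W \<in> O[at_right 0](\<lambda>h. h ^ p)"

definition initial_values_of_order ::
  "real Matrix.vec \<Rightarrow> (real \<Rightarrow> 'v::real_normed_vector) \<Rightarrow> (real \<Rightarrow> nat \<Rightarrow> nat \<Rightarrow> 'v) \<Rightarrow> nat \<Rightarrow> bool"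
where
  "initial_values_of_order c u W p \<longleftrightarrow>
     (\<forall>i<dim_vec c. (\<lambda>h. norm (W h 0 i - u (c $ i * h))) \<in> O[at_right 0](\<lambda>h. h ^ p))"

end

theory Submission
  imports Defs "Jordan_Normal_Form.Determinant"
begin

text \<open>
  Insert the exact solution into the recursion. At a step ending at \<open>t\<close>, Taylor expansion about
  \<open>t\<close> shows that all residual terms up to \<open>h\<^sup>s\<close> vanish by the stage order and by the exactness
  of the extrapolation on polynomials of degree less than \<open>s\<close>, so that the residual is
  \<open>h\<^bsup>s+1\<^esup> (d\<^sub>s\<^sub>+\<^sub>1 u\<^bsup>(s+1)\<^esup>(t) + R l\<^sub>s \<phi>\<^bsup>(s)\<^esup>(t)) + O(h\<^bsup>s+2\<^esup>)\<close> with \<open>\<phi> = F\<^sub>0 \<circ> u\<close>. Adding up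
  \<open>O(1/h)\<close> residuals of size \<open>h\<^bsup>s+1\<^esup>\<close> would only give order \<open>s\<close>. The range conditions
  \<open>d\<^sub>s\<^sub>+\<^sub>1 = (I - P) a\<close> and \<open>R l\<^sub>s = (I - P) b\<close> prevent the accumulation: with
  \<open>g = a u\<^bsup>(s+1)\<^esup> + b \<phi>\<^bsup>(s)\<^esup>\<close> the leading term is \<open>h\<^bsup>s+1\<^esup> (I - P) g(t)\<close>, which equals
  \<open>h\<^bsup>s+1\<^esup> (g(t) - P g(t - h))\<close> up to \<open>O(h\<^bsup>s+2\<^esup>)\<close> because \<open>g\<close> is \<open>C\<^sup>1\<close>. Hence the shifted error
  \<open>x\<^sub>n = w(t\<^sub>n) - w\<^sub>n - h\<^bsup>s+1\<^esup> g(t\<^sub>n)\<close>, which differs from the error by \<open>O(h\<^bsup>s+1\<^esup>)\<close>, satisfies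
  \<open>x\<^sub>n = P x\<^sub>n\<^sub>-\<^sub>1 + O(h) (\<parallel>x\<^sub>n\<^sub>-\<^sub>1\<parallel> + \<parallel>x\<^sub>n\<parallel>) + O(h\<^bsup>s+2\<^esup>)\<close>, and zero-stability together with a
  discrete Gronwall inequality bounds it by \<open>O(h\<^bsup>s+1\<^esup>)\<close> up to time \<open>T\<close>.

  The two halves of this argument are \<open>imex_residual_telescopes\<close> and \<open>stable_recursion_bound\<close>.
  The Lipschitz constants of \<open>F\<^sub>0\<close> and \<open>F\<^sub>1\<close> come from a ball that contains the exact and the
  numerical stages for all small \<open>h\<close> (\<open>imex_rhs_Lipschitz\<close>). Uniformity in \<open>t\<close> of all remainders
  matters, since they are added up over all steps; \<open>uniformly_O\<close> keeps track of it.
\<close>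


section \<open>Continuously differentiable functions\<close>

lemma Ck_on_cong:
  assumes "open S" "\<And>x. x \<in> S \<Longrightarrow> f x = g x" "Ck_on k f S"
  shows "Ck_on k g S"
  using assms(2,3)
proof (induction k arbitrary: f g)
  case 0
  then show ?case
    using continuous_on_eq by auto
next
  case (Suc k)
  have eq: "(f has_derivative D) (at x) \<longleftrightarrow> (g has_derivative D) (at x)" if "x \<in> S" for x D
    using has_derivative_transform_within_open[OF _ assms(1) that] Suc.prems(1) by metis
  have "frechet_derivative f (at x) = frechet_derivative g (at x)" if "x \<in> S" for x
    using eq[OF that] by (simp add: frechet_derivative_def)
  moreover have "g differentiable (at x)" if "x \<in> S" for x
    using Suc.prems(2) that eq[OF that] by (metis Ck_on.simps(2) differentiable_def)
  ultimately show ?case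
    using Suc.prems(2) Suc.IH[of "\<lambda>x. frechet_derivative f (at x) v" "\<lambda>x. frechet_derivative g (at x) v" for v]
    by auto
qed

lemma Ck_on_SucI:
  assumes "open S" "\<And>x. x \<in> S \<Longrightarrow> (f has_derivative f' x) (at x)"
    and "\<And>v. Ck_on k (\<lambda>x. f' x v) S"
  shows "Ck_on (Suc k) f S"
proof -
  have "f' x = frechet_derivative f (at x)" if "x \<in> S" for x
    by (rule frechet_derivative_at[OF assms(2)[OF that]])
  then have "Ck_on k (\<lambda>x. frechet_derivative f (at x) v) S" for v
    using Ck_on_cong[OF assms(1) _ assms(3)] by auto
  then show ?thesis
    using assms(2) by (auto simp: differentiable_def)
qed

lemma Ck_on_has_derivative:
  "Ck_on (Suc k) f S \<Longrightarrow> x \<in> S \<Longrightarrow> (f has_derivative frechet_derivative f (at x)) (at x)"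
  by (simp add: frechet_derivative_works)

lemma Ck_on_SucD: "Ck_on (Suc k) f S \<Longrightarrow> Ck_on k f S"
proof (induction k arbitrary: f)
  case 0
  then show ?case
    by (auto intro!: differentiable_imp_continuous_on differentiable_at_imp_differentiable_on)
next
  case (Suc k)
  then show ?case
    by (metis Ck_on.simps(2))
qed

lemma Ck_on_le: "Ck_on k f S \<Longrightarrow> j \<le> k \<Longrightarrow> Ck_on j f S"
  by (induction k) (auto simp del: Ck_on.simps simp: le_Suc_eq dest: Ck_on_SucD)

lemma Ck_on_imp_continuous_on: "Ck_on k f S \<Longrightarrow> continuous_on S f"
  using Ck_on_le[of k f S 0] by simp

lemma Ck_on_const:
  assumes "open S"
  shows "Ck_on k (\<lambda>_. a) S"
proof (induction k arbitrary: a)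
  case (Suc k)
  then show ?case
    by (intro Ck_on_SucI[where f' = "\<lambda>_ _. 0"] assms) auto
qed simp

lemma Ck_on_add:
  assumes "open S" "Ck_on k f S" "Ck_on k g S"
  shows "Ck_on k (\<lambda>x. f x + g x) S"
  using assms(2,3)
proof (induction k arbitrary: f g)
  case 0
  then show ?case by (auto intro: continuous_intros)
next
  case (Suc k)
  show ?case
    by (rule Ck_on_SucI[OF assms(1), where f' = "\<lambda>x v. frechet_derivative f (at x) v
          + frechet_derivative g (at x) v"])
      (use Suc in \<open>auto intro!: has_derivative_add simp: frechet_derivative_works[symmetric]\<close>)
qed

lemma Ck_on_sum:
  assumes "open S" "\<And>i. i \<in> A \<Longrightarrow> Ck_on k (f i) S"
  shows "Ck_on k (\<lambda>x. \<Sum>i\<in>A. f i x) S"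
  using assms(2)
  by (induction A rule: infinite_finite_induct)
    (auto intro: Ck_on_const[OF assms(1)] Ck_on_add[OF assms(1)])

lemma Ck_on_bounded_linear:
  assumes "bounded_linear L" "open S" "Ck_on k f S"
  shows "Ck_on k (\<lambda>x. L (f x)) S"
  using assms(3)
proof (induction k arbitrary: f)
  case 0
  then show ?case
    using bounded_linear.continuous_on[OF assms(1)] by auto
next
  case (Suc k)
  show ?case
    by (rule Ck_on_SucI[OF assms(2), where f' = "\<lambda>x v. L (frechet_derivative f (at x) v)"])
      (use Suc in \<open>auto intro!: bounded_linear.has_derivative[OF assms(1)]
        simp: frechet_derivative_works[symmetric]\<close>)
qed

lemma Ck_on_scaleR:
  assumes "open S" "Ck_on k f S" "Ck_on k g S"
  shows "Ck_on k (\<lambda>x. f x *\<^sub>R g x) S"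
  using assms(2,3)
proof (induction k arbitrary: f g)
  case 0
  then show ?case by (auto intro: continuous_intros)
next
  case (Suc k)
  have *: "Ck_on k f S" "Ck_on k g S"
    using Suc.prems by (auto simp del: Ck_on.simps intro: Ck_on_SucD)
  show ?case
    by (rule Ck_on_SucI[OF assms(1), where f' = "\<lambda>x v. f x *\<^sub>R frechet_derivative g (at x) v
          + frechet_derivative f (at x) v *\<^sub>R g x"])
      (use Suc * in \<open>auto intro!: has_derivative_scaleR Ck_on_add assms(1)
        simp: frechet_derivative_works[symmetric]\<close>)
qed

lemma linear_in_coordinates:
  fixes f :: "'a::euclidean_space \<Rightarrow> 'b::real_vector"
  assumes "linear f"
  shows "f v = (\<Sum>b\<in>Basis. (v \<bullet> b) *\<^sub>R f b)"
proof -
  interpret linear f by fact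
  have "f v = f (\<Sum>b\<in>Basis. (v \<bullet> b) *\<^sub>R b)"
    by (simp add: euclidean_representation)
  also have "\<dots> = (\<Sum>b\<in>Basis. (v \<bullet> b) *\<^sub>R f b)"
    by (simp only: sum scaleR)
  finally show ?thesis .
qed

text \<open>
  The derivative of a composition is itself a sum of products of compositions once the inner
  derivative is written in coordinates, so the induction on the order closes.
\<close>

lemma Ck_on_compose:
  fixes f :: "'a::euclidean_space \<Rightarrow> 'b::euclidean_space"
    and F :: "'b \<Rightarrow> 'c::real_normed_vector"
  assumes "open S" "Ck_on k F UNIV" "Ck_on k f S"
  shows "Ck_on k (\<lambda>x. F (f x)) S"
  using assms(2,3)
proof (induction k arbitrary: F)
  case 0
  then show ?case
    by (auto intro: continuous_on_compose2)
next
  case (Suc k)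
  have f: "Ck_on k f S"
    using Suc.prems(2) by (rule Ck_on_SucD)
  define F' where "F' y = frechet_derivative F (at y)" for y
  define f' where "f' x = frechet_derivative f (at x)" for x
  have F': "(F has_derivative F' y) (at y)" for y
    unfolding F'_def by (rule Ck_on_has_derivative[OF Suc.prems(1)]) simp
  have f': "(f has_derivative f' x) (at x)" if "x \<in> S" for x
    unfolding f'_def by (rule Ck_on_has_derivative[OF Suc.prems(2) that])
  have coords: "F' y v = (\<Sum>b\<in>Basis. (v \<bullet> b) *\<^sub>R F' y b)" for y v
    by (rule linear_in_coordinates[OF has_derivative_linear[OF F']])
  have "Ck_on k (\<lambda>x. \<Sum>b\<in>Basis. (f' x v \<bullet> b) *\<^sub>R F' (f x) b) S" for v
  proof (intro Ck_on_sum Ck_on_scaleR assms(1))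
    fix b :: 'b
    show "Ck_on k (\<lambda>x. f' x v \<bullet> b) S"
      using Suc.prems(2) unfolding f'_def
      by (intro Ck_on_bounded_linear[OF bounded_linear_inner_left assms(1)]) simp
    show "Ck_on k (\<lambda>x. F' (f x) b) S"
      using Suc.prems(1) f unfolding F'_def by (intro Suc.IH) auto
  qed
  then have "Ck_on k (\<lambda>x. F' (f x) (f' x v)) S" for v
    by (subst coords)
  then show ?case
    using has_derivative_compose[OF f' F']
    by (intro Ck_on_SucI[OF assms(1), where f' = "\<lambda>x v. F' (f x) (f' x v)"]) auto
qed

lemma Ck_on_derivative_sequence:
  fixes f :: "real \<Rightarrow> 'v::real_normed_vector"
  assumes "Ck_on k f S"
  obtains D where "D 0 = f"
    and "\<And>j t. j < k \<Longrightarrow> t \<in> S \<Longrightarrow> (D j has_vector_derivative D (Suc j) t) (at t)"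
    and "\<And>j. j \<le> k \<Longrightarrow> continuous_on S (D j)"
proof -
  have "\<exists>D. D 0 = f \<and> (\<forall>j<k. \<forall>t\<in>S. (D j has_vector_derivative D (Suc j) t) (at t))
      \<and> (\<forall>j\<le>k. continuous_on S (D j))"
    using assms
  proof (induction k arbitrary: f)
    case 0
    then show ?case
      by (intro exI[of _ "\<lambda>_. f"]) auto
  next
    case (Suc k)
    define f' where "f' t = frechet_derivative f (at t) 1" for t
    obtain D where D: "D 0 = f'" "\<And>j t. j < k \<Longrightarrow> t \<in> S \<Longrightarrow> (D j has_vector_derivative D (Suc j) t) (at t)"
      "\<And>j. j \<le> k \<Longrightarrow> continuous_on S (D j)"
      using Suc.IH[of f'] Suc.prems unfolding f'_def by auto
    have f': "(f has_vector_derivative f' t) (at t)" if "t \<in> S" for t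
    proof -
      have d: "(f has_derivative frechet_derivative f (at t)) (at t)"
        by (rule Ck_on_has_derivative[OF Suc.prems that])
      interpret linear "frechet_derivative f (at t)"
        using d has_derivative_linear by blast
      have "frechet_derivative f (at t) x = x *\<^sub>R f' t" for x
        using scaleR[of x 1] unfolding f'_def real_scaleR_def mult_1_right .
      then have "frechet_derivative f (at t) = (\<lambda>x. x *\<^sub>R f' t)"
        by blast
      with d show ?thesis
        by (simp add: has_vector_derivative_def)
    qed
    have "continuous_on S f"
      by (rule Ck_on_imp_continuous_on[OF Suc.prems])
    with f' D show ?case
      by (intro exI[of _ "case_nat f D"]) (auto split: nat.split simp: less_Suc_eq_0_disj le_Suc_eq)
  qed
  with that show thesis
    by blast
qed

text \<open>
  The derivative is bounded on the ball: each of its finitely many values on basis vectors is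
  continuous on a compact set.
\<close>

lemma C1_Lipschitz_on_cball:
  fixes F :: "'a::euclidean_space \<Rightarrow> 'b::real_normed_vector"
  assumes "Ck_on 1 F UNIV"
  obtains L where "L \<ge> 0" "\<And>x y. x \<in> cball 0 r \<Longrightarrow> y \<in> cball 0 r \<Longrightarrow> norm (F x - F y) \<le> L * norm (x - y)"
proof -
  define F' where "F' x = frechet_derivative F (at x)" for x
  have C1: "Ck_on (Suc 0) F UNIV"
    using assms by simp
  have F': "(F has_derivative F' x) (at x)" for x
    unfolding F'_def by (rule Ck_on_has_derivative[OF C1]) simp
  have "\<exists>B. \<forall>x\<in>cball 0 r. norm (F' x b) \<le> B" for b
  proof -
    have "continuous_on (cball 0 r) (\<lambda>x. F' x b)"
      using C1 unfolding F'_def by (auto intro: continuous_on_subset)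
    then have "compact ((\<lambda>x. F' x b) ` cball 0 r)"
      by (rule compact_continuous_image) simp
    then show ?thesis
      by (auto dest!: compact_imp_bounded simp: bounded_iff)
  qed
  then obtain B where B: "\<And>b x. x \<in> cball 0 r \<Longrightarrow> norm (F' x b) \<le> B b"
    by metis
  \<comment> \<open>The maximum with \<open>0\<close> covers an empty ball, where nothing is known about \<open>B\<close>.\<close>
  define L where "L = max 0 (\<Sum>b\<in>Basis. B b)"
  have on: "onorm (F' x) \<le> L" if x: "x \<in> cball 0 r" for x
  proof (rule onorm_le)
    fix v
    have "norm (F' x v) = norm (\<Sum>b\<in>Basis. (v \<bullet> b) *\<^sub>R F' x b)"
      using linear_in_coordinates[OF has_derivative_linear[OF F']] by metis
    also have "\<dots> \<le> (\<Sum>b\<in>Basis. norm v * B b)"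
    proof (intro sum_norm_le)
      fix b :: 'a assume b: "b \<in> Basis"
      have "\<bar>v \<bullet> b\<bar> * norm (F' x b) \<le> norm v * B b"
        using B[OF x, of b] Basis_le_norm[OF b, of v] by (intro mult_mono) auto
      then show "norm ((v \<bullet> b) *\<^sub>R F' x b) \<le> norm v * B b"
        by simp
    qed
    also have "\<dots> = (\<Sum>b\<in>Basis. B b) * norm v"
      by (simp add: sum_distrib_left mult.commute)
    also have "\<dots> \<le> L * norm v"
      by (intro mult_right_mono) (auto simp: L_def)
    finally show "norm (F' x v) \<le> L * norm v" .
  qed
  show thesis
  proof (rule that[of L])
    show "L \<ge> 0"
      by (simp add: L_def)
    show "norm (F x - F y) \<le> L * norm (x - y)" if "x \<in> cball 0 r" "y \<in> cball 0 r" for x y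
      by (rule differentiable_bound[where S = "cball 0 r" and f' = F'])
        (use that on in \<open>auto intro: has_derivative_at_withinI[OF F']\<close>)
  qed
qed


section \<open>Taylor expansion with a remainder that is uniform in the base point\<close>

text \<open>
  Induction on the order: the derivative of the remainder of order \<open>Suc p\<close> is the remainder of
  order \<open>p\<close> of the derivative, and the mean value inequality integrates its bound. The points
  \<open>w\<close> and \<open>z\<close> may come in either order.
\<close>

lemma Taylor_bound:
  fixes D :: "nat \<Rightarrow> real \<Rightarrow> 'v::real_normed_vector"
  assumes "is_interval S" "w \<in> S" "z \<in> S"
    and "\<And>j t. j < p \<Longrightarrow> t \<in> S \<Longrightarrow> (D j has_vector_derivative D (Suc j) t) (at t)"
    and "\<And>t. t \<in> S \<Longrightarrow> norm (D p t) \<le> B"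
  shows "norm (D 0 z - (\<Sum>j<p. ((z - w) ^ j / fact j) *\<^sub>R D j w)) \<le> B * \<bar>z - w\<bar> ^ p"
  using assms(3-)
proof (induction p arbitrary: D z)
  case 0
  then show ?case by simp
next
  case (Suc p)
  define r where "r x = D 0 x - (\<Sum>j<Suc p. ((x - w) ^ j / fact j) *\<^sub>R D j w)" for x
  define r' where "r' x = D 1 x - (\<Sum>j<p. ((x - w) ^ j / fact j) *\<^sub>R D (Suc j) w)" for x
  have r_eq: "r = (\<lambda>x. D 0 x - (D 0 w + (\<Sum>j<p. ((x - w) ^ Suc j / fact (Suc j)) *\<^sub>R D (Suc j) w)))"
    unfolding r_def by (subst sum.lessThan_Suc_shift) simp
  have seg: "closed_segment w z \<subseteq> S"
    using assms(1,2) Suc.prems(1) by (simp add: closed_segment_subset is_interval_convex)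
  have "B \<ge> 0"
    using Suc.prems(3)[OF assms(2)] norm_ge_zero order_trans by blast
  have "norm (r z - r w) \<le> (B * \<bar>z - w\<bar> ^ p) * norm (z - w)"
  proof (rule differentiable_bound[where S = "closed_segment w z" and f' = "\<lambda>x h. h *\<^sub>R r' x"])
    fix x assume x: "x \<in> closed_segment w z"
    then have xS: "x \<in> S"
      using seg by blast
    have "((\<lambda>x. ((x - w) ^ Suc j / fact (Suc j)) *\<^sub>R D (Suc j) w) has_vector_derivative
        ((x - w) ^ j / fact j) *\<^sub>R D (Suc j) w) (at x)" for j
    proof -
      have "((\<lambda>x. (x - w) ^ Suc j / fact (Suc j)) has_real_derivative
          (real (Suc j) * (x - w) ^ j) / fact (Suc j)) (at x)"
        by (rule derivative_eq_intros refl | simp)+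
      also have "(real (Suc j) * (x - w) ^ j) / fact (Suc j) = (x - w) ^ j / fact j"
        by (simp add: divide_simps)
      finally show ?thesis
        using has_vector_derivative_scaleR[OF _ has_vector_derivative_const, of _ _ x UNIV "D (Suc j) w"]
        by simp
    qed
    then have deriv_sum: "((\<lambda>x. \<Sum>j<p. ((x - w) ^ Suc j / fact (Suc j)) *\<^sub>R D (Suc j) w) has_vector_derivative
        (\<Sum>j<p. ((x - w) ^ j / fact j) *\<^sub>R D (Suc j) w)) (at x)"
      by (intro has_vector_derivative_sum) auto
    have deriv_D: "(D 0 has_vector_derivative D 1 x) (at x)"
      using Suc.prems(2)[of 0 x] xS by simp
    have "(r has_vector_derivative r' x) (at x)"
      unfolding r_eq r'_def
      using has_vector_derivative_diff[OF deriv_D has_vector_derivative_add[OF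
            has_vector_derivative_const[of "D 0 w"] deriv_sum]]
      by (simp only: add_0)
    then show "(r has_derivative (\<lambda>h. h *\<^sub>R r' x)) (at x within closed_segment w z)"
      by (simp add: has_vector_derivative_def has_derivative_at_withinI)
    have "norm (r' x) \<le> B * \<bar>x - w\<bar> ^ p"
      unfolding r'_def using Suc.IH[of x "\<lambda>j. D (Suc j)"] Suc.prems xS by simp
    also have "\<dots> \<le> B * \<bar>z - w\<bar> ^ p"
      using x \<open>B \<ge> 0\<close> by (intro mult_left_mono power_mono) (auto simp: closed_segment_eq_real_ivl split: if_splits)
    finally show "onorm (\<lambda>h. h *\<^sub>R r' x) \<le> B * \<bar>z - w\<bar> ^ p"
      by (intro onorm_le) (auto simp: mult.commute intro!: mult_left_mono)
  qed auto
  moreover have "r w = 0"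
    by (simp add: r_eq)
  ultimately show ?case
    by (simp add: r_def mult_ac)
qed

text \<open>
  The remainder estimate needed for the residuals: a bound \<open>O(h^p)\<close> as \<open>h\<close> tends to \<open>0\<close> from
  the right whose constant and range of \<open>h\<close> serve all \<open>t \<in> {0..T}\<close> at once.
\<close>

definition uniformly_O :: "real \<Rightarrow> nat \<Rightarrow> (real \<Rightarrow> real \<Rightarrow> 'v::real_normed_vector) \<Rightarrow> bool" where
  "uniformly_O T p r \<longleftrightarrow> (\<exists>C. \<forall>\<^sub>F h in at_right 0. \<forall>t\<in>{0..T}. norm (r h t) \<le> C * h ^ p)"

lemma eventually_at_right_0_I: "a > 0 \<Longrightarrow> (\<And>h. 0 < h \<Longrightarrow> h < a \<Longrightarrow> P h) \<Longrightarrow> \<forall>\<^sub>F h in at_right (0::real). P h"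
  unfolding eventually_at_right_field by auto

lemma eventually_pos_at_right_0: "\<forall>\<^sub>F h in at_right (0::real). h > 0"
  by (simp add: eventually_at_right_less)

lemma uniformly_O_cong:
  assumes "uniformly_O T p r" "\<forall>\<^sub>F h in at_right 0. \<forall>t\<in>{0..T}. r h t = r' h t"
  shows "uniformly_O T p r'"
proof -
  obtain C where "\<forall>\<^sub>F h in at_right 0. \<forall>t\<in>{0..T}. norm (r h t) \<le> C * h ^ p"
    using assms(1) by (auto simp: uniformly_O_def)
  then have "\<forall>\<^sub>F h in at_right 0. \<forall>t\<in>{0..T}. norm (r' h t) \<le> C * h ^ p"
    using assms(2) by eventually_elim auto
  then show ?thesis
    by (auto simp: uniformly_O_def)
qed

lemma uniformly_O_zero: "uniformly_O T p (\<lambda>_ _. 0)"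
  unfolding uniformly_O_def by (intro exI[of _ 0]) simp

lemma uniformly_O_add:
  assumes "uniformly_O T p r" "uniformly_O T p r'"
  shows "uniformly_O T p (\<lambda>h t. r h t + r' h t)"
proof -
  obtain C C' where "\<forall>\<^sub>F h in at_right 0. \<forall>t\<in>{0..T}. norm (r h t) \<le> C * h ^ p"
    "\<forall>\<^sub>F h in at_right 0. \<forall>t\<in>{0..T}. norm (r' h t) \<le> C' * h ^ p"
    using assms by (auto simp: uniformly_O_def)
  then have "\<forall>\<^sub>F h in at_right 0. \<forall>t\<in>{0..T}. norm (r h t + r' h t) \<le> (C + C') * h ^ p"
    by eventually_elim (auto intro: norm_triangle_mono simp: distrib_right)
  then show ?thesis
    by (auto simp: uniformly_O_def)
qed

lemma uniformly_O_scaleR: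
  assumes "uniformly_O T p r"
  shows "uniformly_O T p (\<lambda>h t. a *\<^sub>R r h t)"
proof -
  obtain C where "\<forall>\<^sub>F h in at_right 0. \<forall>t\<in>{0..T}. norm (r h t) \<le> C * h ^ p"
    using assms by (auto simp: uniformly_O_def)
  then have "\<forall>\<^sub>F h in at_right 0. \<forall>t\<in>{0..T}. norm (a *\<^sub>R r h t) \<le> (\<bar>a\<bar> * C) * h ^ p"
    by eventually_elim (auto intro: mult_left_mono simp: mult.assoc)
  then show ?thesis
    by (auto simp: uniformly_O_def)
qed

lemma uniformly_O_diff:
  assumes "uniformly_O T p r" "uniformly_O T p r'"
  shows "uniformly_O T p (\<lambda>h t. r h t - r' h t)"
  using uniformly_O_add[OF assms(1) uniformly_O_scaleR[OF assms(2), of "-1"]] by simp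

lemma uniformly_O_sum:
  assumes "\<And>i. i \<in> A \<Longrightarrow> uniformly_O T p (r i)"
  shows "uniformly_O T p (\<lambda>h t. \<Sum>i\<in>A. r i h t)"
  using assms
  by (induction A rule: infinite_finite_induct) (auto intro: uniformly_O_zero uniformly_O_add)

lemma uniformly_O_power_mult:
  assumes "uniformly_O T p r"
  shows "uniformly_O T (q + p) (\<lambda>h t. (h ^ q) *\<^sub>R r h t)"
proof -
  obtain C where "\<forall>\<^sub>F h in at_right 0. \<forall>t\<in>{0..T}. norm (r h t) \<le> C * h ^ p"
    using assms by (auto simp: uniformly_O_def)
  then have "\<forall>\<^sub>F h in at_right 0. \<forall>t\<in>{0..T}. norm ((h ^ q) *\<^sub>R r h t) \<le> C * h ^ (q + p)"
    using eventually_pos_at_right_0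
  proof eventually_elim
    case (elim h)
    show ?case
    proof
      fix t assume "t \<in> {0..T}"
      then have "h ^ q * norm (r h t) \<le> h ^ q * (C * h ^ p)"
        using elim by (intro mult_left_mono) auto
      then show "norm ((h ^ q) *\<^sub>R r h t) \<le> C * h ^ (q + p)"
        using elim by (simp add: power_add mult_ac)
    qed
  qed
  then show ?thesis
    by (auto simp: uniformly_O_def)
qed

lemma interval_neighbourhood:
  fixes J :: "real set"
  assumes "T > 0" "open J" "is_interval J" "{0..T} \<subseteq> J"
  obtains e where "e > 0" "{-e..T + e} \<subseteq> J"
proof -
  have "0 \<in> J" "T \<in> J"
    using assms(1,4) by auto
  then obtain a b where ab: "a > 0" "cball 0 a \<subseteq> J" "b > 0" "cball T b \<subseteq> J"
    using assms(2) open_contains_cball by metis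
  define e where "e = min a b"
  have "-e \<in> cball 0 a" "T + e \<in> cball T b"
    using ab by (auto simp: e_def dist_real_def)
  then have "-e \<in> J" "T + e \<in> J"
    using ab by auto
  then have "{-e..T + e} \<subseteq> J"
    using mem_is_interval_1_I[OF assms(3)] by (metis atLeastAtMost_iff subsetI)
  then show thesis
    using ab by (intro that[of e]) (auto simp: e_def)
qed

lemma eventually_shifted_in_interval:
  fixes \<alpha> :: real
  assumes "e > 0"
  shows "\<forall>\<^sub>F h in at_right 0. \<forall>t\<in>{0..T}. t + \<alpha> * h \<in> {-e..T + e}"
proof (rule eventually_at_right_0_I[of "e / (\<bar>\<alpha>\<bar> + 1)"])
  fix h :: real assume h: "0 < h" "h < e / (\<bar>\<alpha>\<bar> + 1)"
  have "\<bar>\<alpha> * h\<bar> \<le> (\<bar>\<alpha>\<bar> + 1) * h"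
    using h by (simp add: abs_mult algebra_simps)
  also have "\<dots> \<le> e"
    using h by (simp add: field_simps)
  finally show "\<forall>t\<in>{0..T}. t + \<alpha> * h \<in> {-e..T + e}"
    by auto
qed (use assms in auto)

lemma Taylor_uniformly_O:
  fixes D :: "nat \<Rightarrow> real \<Rightarrow> 'v::real_normed_vector"
  assumes J: "T > 0" "open J" "is_interval J" "{0..T} \<subseteq> J"
    and D: "\<And>j t. j < p \<Longrightarrow> t \<in> J \<Longrightarrow> (D j has_vector_derivative D (Suc j) t) (at t)"
    and cont: "continuous_on J (D p)"
  shows "uniformly_O T p (\<lambda>h t. D 0 (t + \<alpha> * h) - (\<Sum>j<p. ((\<alpha> * h) ^ j / fact j) *\<^sub>R D j t))"
proof -
  obtain e where e: "e > 0" "{-e..T + e} \<subseteq> J"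
    using interval_neighbourhood[OF J] .
  have "compact (D p ` {-e..T + e})"
    using cont e by (intro compact_continuous_image) (auto intro: continuous_on_subset)
  then obtain B where "\<forall>t\<in>{-e..T + e}. norm (D p t) \<le> B"
    by (auto dest!: compact_imp_bounded simp: bounded_iff)
  then have B: "norm (D p t) \<le> B" if "t \<in> {-e..T + e}" for t
    using that by blast
  have "\<forall>\<^sub>F h in at_right 0. \<forall>t\<in>{0..T}. norm (D 0 (t + \<alpha> * h) - (\<Sum>j<p. ((\<alpha> * h) ^ j / fact j) *\<^sub>R D j t))
      \<le> (B * \<bar>\<alpha>\<bar> ^ p) * h ^ p"
    using eventually_shifted_in_interval[OF e(1), of T \<alpha>] eventually_pos_at_right_0
  proof eventually_elim
    case (elim h)
    show ?case
    proof
      fix t assume t: "t \<in> {0..T}"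
      have "norm (D 0 (t + \<alpha> * h) - (\<Sum>j<p. ((t + \<alpha> * h - t) ^ j / fact j) *\<^sub>R D j t))
          \<le> B * \<bar>t + \<alpha> * h - t\<bar> ^ p"
        using elim t e B by (intro Taylor_bound[where S = "{-e..T + e}"] D) (auto simp: is_interval_cc)
      then show "norm (D 0 (t + \<alpha> * h) - (\<Sum>j<p. ((\<alpha> * h) ^ j / fact j) *\<^sub>R D j t))
          \<le> (B * \<bar>\<alpha>\<bar> ^ p) * h ^ p"
        using elim by (simp add: abs_mult power_mult_distrib mult.assoc)
    qed
  qed
  then show ?thesis
    unfolding uniformly_O_def by blast
qed


section \<open>Matrices acting on stage vectors\<close>

lemma mat_act_add_right: "mat_act A (\<lambda>k. w k + w' k) i = mat_act A w i + mat_act A w' i"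
  by (simp add: mat_act_def scaleR_add_right sum.distrib)

lemma mat_act_diff_right: "mat_act A (\<lambda>k. w k - w' k) i = mat_act A w i - mat_act A w' i"
  by (simp add: mat_act_def scaleR_diff_right sum_subtractf)

lemma mat_act_scaleR_right: "mat_act A (\<lambda>k. a *\<^sub>R w k) i = a *\<^sub>R mat_act A w i"
  by (simp add: mat_act_def scaleR_sum_right mult.commute)

lemma mat_act_sum_right: "mat_act A (\<lambda>k. \<Sum>j\<in>I. w j k) i = (\<Sum>j\<in>I. mat_act A (w j) i)"
  by (induction I rule: infinite_finite_induct) (simp_all add: mat_act_add_right, simp_all add: mat_act_def)

lemma mat_act_cong: "(\<And>k. k < dim_col A \<Longrightarrow> w k = w' k) \<Longrightarrow> mat_act A w i = mat_act A w' i"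
  by (simp add: mat_act_def)

lemma mat_act_add_mat:
  assumes "A \<in> carrier_mat n m" "B \<in> carrier_mat n m" "i < n"
  shows "mat_act (A + B) w i = mat_act A w i + mat_act B w i"
  using assms by (simp add: mat_act_def scaleR_add_left sum.distrib)

lemma mat_act_diff_mat:
  assumes "A \<in> carrier_mat n m" "B \<in> carrier_mat n m" "i < n"
  shows "mat_act (A - B) w i = mat_act A w i - mat_act B w i"
  using assms by (simp add: mat_act_def scaleR_diff_left sum_subtractf)

lemma mat_act_mult_mat:
  assumes "A \<in> carrier_mat n m" "B \<in> carrier_mat m l" "i < n"
  shows "mat_act (A * B) w i = mat_act A (mat_act B w) i"
proof -
  have "mat_act (A * B) w i = (\<Sum>j<l. \<Sum>k<m. (A $$ (i, k) * B $$ (k, j)) *\<^sub>R w j)"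
    using assms unfolding mat_act_def
    by (intro sum.cong) (auto simp: scalar_prod_def scaleR_sum_left atLeast0LessThan)
  also have "\<dots> = (\<Sum>k<m. \<Sum>j<l. (A $$ (i, k) * B $$ (k, j)) *\<^sub>R w j)"
    by (rule sum.swap)
  also have "\<dots> = mat_act A (mat_act B w) i"
    using assms by (simp add: mat_act_def scaleR_sum_right)
  finally show ?thesis .
qed

lemma mat_act_one: "i < n \<Longrightarrow> mat_act (1\<^sub>m n) w i = w i"
proof -
  assume i: "i < n"
  have "mat_act (1\<^sub>m n) w i = (\<Sum>j<n. if j = i then w j else 0)"
    using i unfolding mat_act_def by (intro sum.cong) auto
  also have "\<dots> = w i"
    using i by (subst sum.delta) auto
  finally show ?thesis .
qed

lemma mat_act_scaled_vector:
  assumes "A \<in> carrier_mat n m" "v \<in> carrier_vec m" "i < n"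
  shows "mat_act A (\<lambda>k. (v $ k) *\<^sub>R x) i = ((A *\<^sub>v v) $ i) *\<^sub>R x"
  using assms by (simp add: mat_act_def scalar_prod_def scaleR_sum_left atLeast0LessThan)

lemma norm_mat_act_le:
  assumes "\<And>k. k < dim_col A \<Longrightarrow> \<bar>A $$ (i, k)\<bar> \<le> K" "\<And>k. k < dim_col A \<Longrightarrow> norm (w k) \<le> b" "K \<ge> 0"
  shows "norm (mat_act A w i) \<le> (real (dim_col A) * K) * b"
proof -
  have "norm (mat_act A w i) \<le> (\<Sum>k<dim_col A. K * b)"
    unfolding mat_act_def
    by (intro sum_norm_le) (auto intro!: mult_mono assms)
  then show ?thesis
    by simp
qed

lemma mat_act_bounded:
  assumes "A \<in> carrier_mat n m"
  obtains K where "K \<ge> 0"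
    "\<And>w b i. i < n \<Longrightarrow> (\<And>k. k < m \<Longrightarrow> norm (w k) \<le> b) \<Longrightarrow> norm (mat_act A w i :: 'v::real_normed_vector) \<le> K * b"
proof -
  define K where "K = Max (insert 0 ((\<lambda>(i, k). \<bar>A $$ (i, k)\<bar>) ` ({..<n} \<times> {..<m})))"
  have fin: "finite (insert 0 ((\<lambda>(i, k). \<bar>A $$ (i, k)\<bar>) ` ({..<n} \<times> {..<m})))"
    by auto
  have "K \<ge> 0"
    unfolding K_def by (rule Max_ge[OF fin]) auto
  moreover have "\<bar>A $$ (i, k)\<bar> \<le> K" if "i < n" "k < m" for i k
    unfolding K_def by (rule Max_ge[OF fin]) (use that in force)
  ultimately have "norm (mat_act A w i) \<le> (real m * K) * b"
    if "i < n" "\<And>k. k < m \<Longrightarrow> norm (w k) \<le> b" for w :: "nat \<Rightarrow> 'v" and b i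
    using assms that norm_mat_act_le[of A i K w b] by auto
  with \<open>K \<ge> 0\<close> show thesis
    by (intro that[of "real m * K"]) auto
qed

lemma uniformly_O_mat_act:
  assumes "\<And>k. k < dim_col A \<Longrightarrow> uniformly_O T p (\<lambda>h t. r h t k)"
  shows "uniformly_O T p (\<lambda>h t. mat_act A (r h t) i)"
  unfolding mat_act_def using assms by (intro uniformly_O_sum uniformly_O_scaleR) auto

lemma vec_pow_carrier: "x \<in> carrier_vec n \<Longrightarrow> vec_pow x j \<in> carrier_vec n"
  by (simp add: vec_pow_def)

text \<open>
  In the Taylor expansion of the stage vector of \<open>D 0\<close> at the nodes \<open>x\<close>, the coefficient vector of
  \<open>h^j / fact j\<close> is \<open>x^j\<close>, so a matrix acts on it like on a vector of real numbers.
\<close>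

lemma mat_act_expansion:
  fixes D :: "nat \<Rightarrow> real \<Rightarrow> 'v::real_normed_vector"
  assumes J: "T > 0" "open J" "is_interval J" "{0..T} \<subseteq> J"
    and D: "\<And>j t. j < p \<Longrightarrow> t \<in> J \<Longrightarrow> (D j has_vector_derivative D (Suc j) t) (at t)"
    and cont: "continuous_on J (D p)"
    and A: "A \<in> carrier_mat n m" "x \<in> carrier_vec m" "i < n"
  shows "uniformly_O T p (\<lambda>h t. mat_act A (\<lambda>k. D 0 (t + x $ k * h)) i
    - (\<Sum>j<p. (h ^ j / fact j * (A *\<^sub>v vec_pow x j) $ i) *\<^sub>R D j t))"
proof (rule uniformly_O_cong)
  show "uniformly_O T p (\<lambda>h t. mat_act A (\<lambda>k. D 0 (t + x $ k * h)
      - (\<Sum>j<p. ((x $ k * h) ^ j / fact j) *\<^sub>R D j t)) i)"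
    by (intro uniformly_O_mat_act Taylor_uniformly_O[OF J] D cont)
  have "mat_act A (\<lambda>k. \<Sum>j<p. ((x $ k * h) ^ j / fact j) *\<^sub>R D j t) i
      = (\<Sum>j<p. (h ^ j / fact j * (A *\<^sub>v vec_pow x j) $ i) *\<^sub>R D j t)" for h t
  proof -
    have "mat_act A (\<lambda>k. ((x $ k * h) ^ j / fact j) *\<^sub>R D j t) i
        = (h ^ j / fact j * (A *\<^sub>v vec_pow x j) $ i) *\<^sub>R D j t" for j
    proof -
      have "mat_act A (\<lambda>k. ((x $ k * h) ^ j / fact j) *\<^sub>R D j t) i
          = mat_act A (\<lambda>k. (vec_pow x j $ k) *\<^sub>R ((h ^ j / fact j) *\<^sub>R D j t)) i"
        using A by (intro mat_act_cong) (auto simp: vec_pow_def power_mult_distrib)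
      also have "\<dots> = (h ^ j / fact j * (A *\<^sub>v vec_pow x j) $ i) *\<^sub>R D j t"
        using A by (subst mat_act_scaled_vector[OF A(1) vec_pow_carrier]) (auto simp: mult_ac)
      finally show ?thesis .
    qed
    then show ?thesis
      by (simp add: mat_act_sum_right)
  qed
  then show "\<forall>\<^sub>F h in at_right 0. \<forall>t\<in>{0..T}. mat_act A (\<lambda>k. D 0 (t + x $ k * h)
        - (\<Sum>j<p. ((x $ k * h) ^ j / fact j) *\<^sub>R D j t)) i
      = mat_act A (\<lambda>k. D 0 (t + x $ k * h)) i
        - (\<Sum>j<p. (h ^ j / fact j * (A *\<^sub>v vec_pow x j) $ i) *\<^sub>R D j t)"
    by (simp add: mat_act_diff_right)
qed


section \<open>Order conditions of the coefficients\<close>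

text \<open>
  A vector in the kernel of a Vandermonde matrix lists the coefficients of a polynomial that
  has more roots than its degree allows.
\<close>

lemma det_Vandermonde_nonzero:
  fixes x :: "'a::field Matrix.vec"
  assumes distinct: "\<And>i j. i < n \<Longrightarrow> j < n \<Longrightarrow> i \<noteq> j \<Longrightarrow> x $ i \<noteq> x $ j"
  shows "Determinant.det (Matrix.mat n n (\<lambda>(i, j). x $ i ^ j)) \<noteq> 0"
proof
  define A where "A = Matrix.mat n n (\<lambda>(i, j). x $ i ^ j)"
  have A: "A \<in> carrier_mat n n"
    by (simp add: A_def)
  assume "Determinant.det (Matrix.mat n n (\<lambda>(i, j). x $ i ^ j)) = 0"
  then obtain v where v: "v \<in> carrier_vec n" "v \<noteq> 0\<^sub>v n" "A *\<^sub>v v = 0\<^sub>v n"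
    using det_0_iff_vec_prod_zero[OF A] unfolding A_def by blast
  define p where "p = (\<Sum>j<n. monom (v $ j) j)"
  have coeff: "coeff p j = (if j < n then v $ j else 0)" for j
    by (simp add: p_def coeff_sum)
  have root: "poly p (x $ i) = 0" if "i < n" for i
  proof -
    have "poly p (x $ i) = (A *\<^sub>v v) $ i"
      using that v(1) by (simp add: p_def poly_sum poly_monom A_def scalar_prod_def atLeast0LessThan mult.commute)
    then show ?thesis
      using that v(3) by simp
  qed
  have "p = 0"
  proof (rule ccontr)
    assume "p \<noteq> 0"
    then have n: "n > 0"
      by (cases n) (auto simp: p_def)
    have "degree p < n"
      using n coeff by (intro degree_lessI) auto
    moreover have "card ((\<lambda>i. x $ i) ` {..<n}) = n"
      using distinct by (subst card_image) (auto simp: inj_on_def)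
    moreover have "card ((\<lambda>i. x $ i) ` {..<n}) \<le> card {z. poly p z = 0}"
      using root \<open>p \<noteq> 0\<close> by (intro card_mono poly_roots_finite) auto
    ultimately show False
      using card_poly_roots_bound[OF \<open>p \<noteq> 0\<close>] by linarith
  qed
  then have "v $ j = 0" if "j < n" for j
    using coeff[of j] that by simp
  then have "v = 0\<^sub>v n"
    using v(1) by (intro eq_vecI) auto
  with v(2) show False
    by simp
qed

lemma mat_inv_left:
  assumes "A \<in> carrier_mat n n" "Determinant.det A \<noteq> 0"
  shows "mat_inv A \<in> carrier_mat n n" "mat_inv A * A = 1\<^sub>m n"
proof -
  have "mat_inverse A \<noteq> None"
    using mat_inverse(1)[OF assms(1), where b = "()"] det_non_zero_imp_unit[OF assms, where b = "()"]
    by blast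
  then obtain B where "mat_inverse A = Some B"
    by auto
  then show "mat_inv A \<in> carrier_mat n n" "mat_inv A * A = 1\<^sub>m n"
    using mat_inverse(2)[OF assms(1)] by (auto simp: mat_inv_def)
qed

lemma ones_carrier: "c \<in> carrier_vec n \<Longrightarrow> ones c \<in> carrier_vec n"
  by (auto simp: ones_def)

lemma shifted_nodes_carrier: "c \<in> carrier_vec n \<Longrightarrow> c - ones c \<in> carrier_vec n"
  by (auto simp: ones_def)

lemma shifted_nodes_index: "c \<in> carrier_vec n \<Longrightarrow> k < n \<Longrightarrow> (c - ones c) $ k = c $ k - 1"
  by (auto simp: ones_def)

text \<open>
  The columns of \<open>V\<^sub>0\<close> and \<open>V\<^sub>1\<close> are the powers of the nodes, so \<open>S\<^sub>1 V\<^sub>1 = (I - S\<^sub>2) V\<^sub>0\<close> says that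
  the extrapolation is exact on polynomials of degree less than \<open>s\<close>.
\<close>

lemma peer_S1_exact:
  assumes c: "c \<in> carrier_vec s" and distinct: "\<And>i j. i < s \<Longrightarrow> j < s \<Longrightarrow> i \<noteq> j \<Longrightarrow> c $ i \<noteq> c $ j"
    and S2: "S2 \<in> carrier_mat s s"
  shows "peer_S1 c S2 \<in> carrier_mat s s"
    and "\<And>j. j < s \<Longrightarrow> peer_l c (peer_S1 c S2) S2 j = 0\<^sub>v s"
proof -
  define x where "x = c - ones c"
  have dim: "dim_vec c = s"
    using c by auto
  have x: "x $ k = c $ k - 1" if "k < s" for k
    using c that by (auto simp: x_def ones_def)
  have V1_eq: "V1_mat c = Matrix.mat s s (\<lambda>(i, j). x $ i ^ j)"
    using dim x by (auto simp: V1_mat_def)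
  have V0: "V0_mat c \<in> carrier_mat s s" and V1: "V1_mat c \<in> carrier_mat s s"
    using dim by (auto simp: V0_mat_def V1_mat_def)
  have "Determinant.det (V1_mat c) \<noteq> 0"
    unfolding V1_eq by (rule det_Vandermonde_nonzero) (use x distinct in auto)
  note inv = mat_inv_left[OF V1 this]
  have IS2: "1\<^sub>m s - S2 \<in> carrier_mat s s"
    using S2 by auto
  show S1: "peer_S1 c S2 \<in> carrier_mat s s"
    unfolding peer_S1_def dim using IS2 V0 inv by auto
  have exact: "peer_S1 c S2 * V1_mat c = (1\<^sub>m s - S2) * V0_mat c"
    unfolding peer_S1_def dim using assoc_mult_mat[OF mult_carrier_mat[OF IS2 V0] inv(1) V1] inv(2)
      right_mult_one_mat[OF mult_carrier_mat[OF IS2 V0]] by simp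
  fix j assume j: "j < s"
  have "col (peer_S1 c S2 * V1_mat c) j = col ((1\<^sub>m s - S2) * V0_mat c) j"
    by (simp only: exact)
  moreover have "col (peer_S1 c S2 * V1_mat c) j = peer_S1 c S2 *\<^sub>v col (V1_mat c) j"
    using S1 V1 j by (intro eq_vecI) auto
  moreover have "col ((1\<^sub>m s - S2) * V0_mat c) j = (1\<^sub>m s - S2) *\<^sub>v col (V0_mat c) j"
    using IS2 V0 j by (intro eq_vecI) auto
  moreover have "col (V1_mat c) j = vec_pow (c - ones c) j"
    using dim j x by (intro eq_vecI) (auto simp: V1_mat_def vec_pow_def ones_def)
  moreover have "col (V0_mat c) j = vec_pow c j"
    using dim j by (intro eq_vecI) (auto simp: V0_mat_def vec_pow_def)
  ultimately show "peer_l c (peer_S1 c S2) S2 j = 0\<^sub>v s"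
    using IS2 vec_pow_carrier[OF c, of j] by (intro eq_vecI) (auto simp: peer_l_def dim)
qed

lemma peer_d_index:
  assumes "c \<in> carrier_vec s" "P \<in> carrier_mat s s" "Q \<in> carrier_mat s s" "R \<in> carrier_mat s s" "i < s"
  shows "peer_d c P Q R j $ i = ((1\<^sub>m s *\<^sub>v vec_pow c j) $ i - (P *\<^sub>v vec_pow (c - ones c) j) $ i
    - real j * (Q *\<^sub>v vec_pow (c - ones c) (j - 1)) $ i - real j * (R *\<^sub>v vec_pow c (j - 1)) $ i) / fact j"
  using assms vec_pow_carrier[OF assms(1)] by (simp add: peer_d_def)

lemma peer_l_index:
  assumes "c \<in> carrier_vec s" "S1 \<in> carrier_mat s s" "S2 \<in> carrier_mat s s" "i < s"
  shows "peer_l c S1 S2 j $ i = (((1\<^sub>m s - S2) *\<^sub>v vec_pow c j) $ i - (S1 *\<^sub>v vec_pow (c - ones c) j) $ i) / fact j"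
  using assms by (simp add: peer_l_def)

text \<open>Pre-consistency is the order condition of index \<open>0\<close>, because \<open>c^0 = (c - e)^0 = e\<close>.\<close>

lemma stage_order_imp_peer_d_eq_0:
  assumes "c \<in> carrier_vec s" "P \<in> carrier_mat s s" "Q \<in> carrier_mat s s" "R \<in> carrier_mat s s"
    and "stage_order c P Q R q" "j \<le> q"
  shows "peer_d c P Q R j = 0\<^sub>v s"
proof (cases "j = 0")
  case True
  have "vec_pow c 0 = ones c" "vec_pow (c - ones c) 0 = ones c"
    using assms(1) by (auto simp: vec_pow_def ones_def intro!: eq_vecI)
  then show ?thesis
    using assms True peer_d_index[OF assms(1-4), of _ 0] ones_carrier[OF assms(1)]
    by (intro eq_vecI) (auto simp: stage_order_def peer_d_def)
next
  case False
  then show ?thesis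
    using assms by (auto simp: stage_order_def)
qed


section \<open>Residuals of the exact solution\<close>

text \<open>
  Collecting equal powers of \<open>h\<close> in the Taylor expansions, the coefficient of \<open>h^j\<close> is \<open>d\<^sub>j\<close>
  times the \<open>j\<close>-th derivative, and only \<open>j = s + 1\<close> survives the order conditions.
\<close>

lemma implicit_residual_expansion:
  fixes D :: "nat \<Rightarrow> real \<Rightarrow> 'v::real_normed_vector"
  assumes J: "T > 0" "open J" "is_interval J" "{0..T} \<subseteq> J"
    and D: "\<And>j t. j < s + 2 \<Longrightarrow> t \<in> J \<Longrightarrow> (D j has_vector_derivative D (Suc j) t) (at t)"
    and cont: "continuous_on J (D (s + 2))"
    and c: "c \<in> carrier_vec s"
    and mats: "P \<in> carrier_mat s s" "Q \<in> carrier_mat s s" "R \<in> carrier_mat s s"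
    and order: "stage_order c P Q R s" and i: "i < s"
  shows "uniformly_O T (s + 2) (\<lambda>h t. D 0 (t + c $ i * h)
      - mat_act P (\<lambda>k. D 0 (t + (c $ k - 1) * h)) i
      - h *\<^sub>R mat_act Q (\<lambda>k. D 1 (t + (c $ k - 1) * h)) i
      - h *\<^sub>R mat_act R (\<lambda>k. D 1 (t + c $ k * h)) i
      - (h ^ (s + 1) * peer_d c P Q R (s + 1) $ i) *\<^sub>R D (s + 1) t)"
proof -
  define x where "x = c - ones c"
  have x: "x \<in> carrier_vec s" "\<And>k. k < s \<Longrightarrow> x $ k = c $ k - 1"
    using shifted_nodes_carrier[OF c] shifted_nodes_index[OF c] by (auto simp: x_def)
  define S where "S a h t = (\<Sum>j<s + 2. (h ^ j / fact j * a j) *\<^sub>R D j t)" for a :: "nat \<Rightarrow> real" and h t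
  have val: "uniformly_O T (s + 2) (\<lambda>h t. mat_act A (\<lambda>k. D 0 (t + y $ k * h)) i
      - S (\<lambda>j. (A *\<^sub>v vec_pow y j) $ i) h t)"
    if "A \<in> carrier_mat s s" "y \<in> carrier_vec s" for A y
    unfolding S_def by (rule mat_act_expansion[OF J D cont that i])
  \<comment> \<open>Shifting the index of the expansion of \<open>u'\<close> by one turns \<open>1 / fact j\<close> into
    \<open>real (j + 1) / fact (j + 1)\<close>; the added term of index \<open>0\<close> vanishes because of the factor \<open>real j\<close>,
    so the truncated \<open>j - 1\<close> does no harm.\<close>
  have der: "uniformly_O T (s + 2) (\<lambda>h t. h *\<^sub>R mat_act A (\<lambda>k. D 1 (t + y $ k * h)) i
      - S (\<lambda>j. real j * (A *\<^sub>v vec_pow y (j - 1)) $ i) h t)"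
    if "A \<in> carrier_mat s s" "y \<in> carrier_vec s" for A y
  proof -
    have "uniformly_O T (s + 1) (\<lambda>h t. mat_act A (\<lambda>k. D (Suc 0) (t + y $ k * h)) i
        - (\<Sum>j<s + 1. (h ^ j / fact j * (A *\<^sub>v vec_pow y j) $ i) *\<^sub>R D (Suc j) t))"
      by (rule mat_act_expansion[OF J, where D = "\<lambda>j. D (Suc j)", OF _ _ that i]) (use D cont in auto)
    from uniformly_O_power_mult[OF this, of 1]
    have "uniformly_O T (s + 2) (\<lambda>h t. h *\<^sub>R (mat_act A (\<lambda>k. D 1 (t + y $ k * h)) i
        - (\<Sum>j<s + 1. (h ^ j / fact j * (A *\<^sub>v vec_pow y j) $ i) *\<^sub>R D (Suc j) t)))"
      by simp
    moreover have "h *\<^sub>R (\<Sum>j<s + 1. (h ^ j / fact j * (A *\<^sub>v vec_pow y j) $ i) *\<^sub>R D (Suc j) t)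
        = S (\<lambda>j. real j * (A *\<^sub>v vec_pow y (j - 1)) $ i) h t" for h t
    proof -
      have "S (\<lambda>j. real j * (A *\<^sub>v vec_pow y (j - 1)) $ i) h t
          = (\<Sum>j<s + 1. (h ^ Suc j / fact (Suc j) * (real (Suc j) * (A *\<^sub>v vec_pow y j) $ i)) *\<^sub>R D (Suc j) t)"
        unfolding S_def add_2_eq_Suc' Suc_eq_plus1[symmetric]
        by (subst sum.lessThan_Suc_shift) simp
      also have "\<dots> = (\<Sum>j<s + 1. h *\<^sub>R ((h ^ j / fact j * (A *\<^sub>v vec_pow y j) $ i) *\<^sub>R D (Suc j) t))"
      proof (intro sum.cong refl)
        fix j
        have "h ^ Suc j / fact (Suc j) * (real (Suc j) * a) = h * (h ^ j / fact j * a)" for a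
          by (simp add: divide_simps del: of_nat_Suc)
        then show "(h ^ Suc j / fact (Suc j) * (real (Suc j) * (A *\<^sub>v vec_pow y j) $ i)) *\<^sub>R D (Suc j) t
            = h *\<^sub>R ((h ^ j / fact j * (A *\<^sub>v vec_pow y j) $ i) *\<^sub>R D (Suc j) t)"
          by (simp only: scaleR_scaleR)
      qed
      finally show ?thesis
        by (simp only: scaleR_sum_right)
    qed
    ultimately show ?thesis
      by (simp add: scaleR_diff_right)
  qed
  have collect: "S (\<lambda>j. (1\<^sub>m s *\<^sub>v vec_pow c j) $ i) h t - S (\<lambda>j. (P *\<^sub>v vec_pow x j) $ i) h t
      - S (\<lambda>j. real j * (Q *\<^sub>v vec_pow x (j - 1)) $ i) h t - S (\<lambda>j. real j * (R *\<^sub>v vec_pow c (j - 1)) $ i) h t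
      = (h ^ (s + 1) * peer_d c P Q R (s + 1) $ i) *\<^sub>R D (s + 1) t" for h t
  proof -
    have "S (\<lambda>j. (1\<^sub>m s *\<^sub>v vec_pow c j) $ i) h t - S (\<lambda>j. (P *\<^sub>v vec_pow x j) $ i) h t
      - S (\<lambda>j. real j * (Q *\<^sub>v vec_pow x (j - 1)) $ i) h t - S (\<lambda>j. real j * (R *\<^sub>v vec_pow c (j - 1)) $ i) h t
      = (\<Sum>j<s + 2. (h ^ j * peer_d c P Q R j $ i) *\<^sub>R D j t)"
      unfolding S_def sum_subtractf[symmetric] peer_d_index[OF c mats i] x_def[symmetric]
      by (intro sum.cong refl) (simp only: scaleR_diff_left[symmetric], simp add: diff_divide_distrib right_diff_distrib)
    also have "\<dots> = (\<Sum>j<Suc (s + 1). (h ^ j * peer_d c P Q R j $ i) *\<^sub>R D j t)"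
      by simp
    also have "\<dots> = (h ^ (s + 1) * peer_d c P Q R (s + 1) $ i) *\<^sub>R D (s + 1) t"
      using stage_order_imp_peer_d_eq_0[OF c mats order] i by (subst sum.lessThan_Suc) simp
    finally show ?thesis .
  qed
  have "uniformly_O T (s + 2) (\<lambda>h t.
      (mat_act (1\<^sub>m s) (\<lambda>k. D 0 (t + c $ k * h)) i - S (\<lambda>j. (1\<^sub>m s *\<^sub>v vec_pow c j) $ i) h t)
      - (mat_act P (\<lambda>k. D 0 (t + x $ k * h)) i - S (\<lambda>j. (P *\<^sub>v vec_pow x j) $ i) h t)
      - (h *\<^sub>R mat_act Q (\<lambda>k. D 1 (t + x $ k * h)) i - S (\<lambda>j. real j * (Q *\<^sub>v vec_pow x (j - 1)) $ i) h t)
      - (h *\<^sub>R mat_act R (\<lambda>k. D 1 (t + c $ k * h)) i - S (\<lambda>j. real j * (R *\<^sub>v vec_pow c (j - 1)) $ i) h t))"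
    by (intro uniformly_O_diff val der one_carrier_mat mats c x)
  then show ?thesis
  proof (rule uniformly_O_cong, intro always_eventually allI ballI)
    fix h t
    have "mat_act P (\<lambda>k. D 0 (t + x $ k * h)) i = mat_act P (\<lambda>k. D 0 (t + (c $ k - 1) * h)) i"
      "mat_act Q (\<lambda>k. D 1 (t + x $ k * h)) i = mat_act Q (\<lambda>k. D 1 (t + (c $ k - 1) * h)) i"
      using mats x by (auto intro!: mat_act_cong)
    then show "(mat_act (1\<^sub>m s) (\<lambda>k. D 0 (t + c $ k * h)) i - S (\<lambda>j. (1\<^sub>m s *\<^sub>v vec_pow c j) $ i) h t)
      - (mat_act P (\<lambda>k. D 0 (t + x $ k * h)) i - S (\<lambda>j. (P *\<^sub>v vec_pow x j) $ i) h t)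
      - (h *\<^sub>R mat_act Q (\<lambda>k. D 1 (t + x $ k * h)) i - S (\<lambda>j. real j * (Q *\<^sub>v vec_pow x (j - 1)) $ i) h t)
      - (h *\<^sub>R mat_act R (\<lambda>k. D 1 (t + c $ k * h)) i - S (\<lambda>j. real j * (R *\<^sub>v vec_pow c (j - 1)) $ i) h t)
      = D 0 (t + c $ i * h) - mat_act P (\<lambda>k. D 0 (t + (c $ k - 1) * h)) i
      - h *\<^sub>R mat_act Q (\<lambda>k. D 1 (t + (c $ k - 1) * h)) i
      - h *\<^sub>R mat_act R (\<lambda>k. D 1 (t + c $ k * h)) i
      - (h ^ (s + 1) * peer_d c P Q R (s + 1) $ i) *\<^sub>R D (s + 1) t"
      unfolding collect[symmetric] mat_act_one[OF i] by (simp add: algebra_simps)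
  qed
qed

text \<open>The same collection of powers for the extrapolation, whose coefficients are the \<open>l\<^sub>j\<close>.\<close>

lemma extrapolation_expansion:
  fixes E :: "nat \<Rightarrow> real \<Rightarrow> 'v::real_normed_vector"
  assumes J: "T > 0" "open J" "is_interval J" "{0..T} \<subseteq> J"
    and E: "\<And>j t. j < s + 1 \<Longrightarrow> t \<in> J \<Longrightarrow> (E j has_vector_derivative E (Suc j) t) (at t)"
    and cont: "continuous_on J (E (s + 1))"
    and c: "c \<in> carrier_vec s"
    and mats: "S1 \<in> carrier_mat s s" "S2 \<in> carrier_mat s s"
    and order: "\<And>j. j < s \<Longrightarrow> peer_l c S1 S2 j = 0\<^sub>v s" and i: "i < s"
  shows "uniformly_O T (s + 1) (\<lambda>h t. mat_act (1\<^sub>m s - S2) (\<lambda>k. E 0 (t + c $ k * h)) i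
      - mat_act S1 (\<lambda>k. E 0 (t + (c $ k - 1) * h)) i
      - (h ^ s * peer_l c S1 S2 s $ i) *\<^sub>R E s t)"
proof -
  define x where "x = c - ones c"
  have x: "x \<in> carrier_vec s" "\<And>k. k < s \<Longrightarrow> x $ k = c $ k - 1"
    using shifted_nodes_carrier[OF c] shifted_nodes_index[OF c] by (auto simp: x_def)
  have IS2: "1\<^sub>m s - S2 \<in> carrier_mat s s"
    using mats by auto
  define S where "S a h t = (\<Sum>j<s + 1. (h ^ j / fact j * a j) *\<^sub>R E j t)" for a :: "nat \<Rightarrow> real" and h t
  have val: "uniformly_O T (s + 1) (\<lambda>h t. mat_act A (\<lambda>k. E 0 (t + y $ k * h)) i
      - S (\<lambda>j. (A *\<^sub>v vec_pow y j) $ i) h t)"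
    if "A \<in> carrier_mat s s" "y \<in> carrier_vec s" for A y
    unfolding S_def by (rule mat_act_expansion[OF J E cont that i])
  have collect: "S (\<lambda>j. ((1\<^sub>m s - S2) *\<^sub>v vec_pow c j) $ i) h t - S (\<lambda>j. (S1 *\<^sub>v vec_pow x j) $ i) h t
      = (h ^ s * peer_l c S1 S2 s $ i) *\<^sub>R E s t" for h t
  proof -
    have "S (\<lambda>j. ((1\<^sub>m s - S2) *\<^sub>v vec_pow c j) $ i) h t - S (\<lambda>j. (S1 *\<^sub>v vec_pow x j) $ i) h t
      = (\<Sum>j<Suc s. (h ^ j * peer_l c S1 S2 j $ i) *\<^sub>R E j t)"
      unfolding S_def sum_subtractf[symmetric] peer_l_index[OF c mats i] x_def[symmetric] Suc_eq_plus1
      by (intro sum.cong refl) (simp only: scaleR_diff_left[symmetric], simp add: diff_divide_distrib right_diff_distrib)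
    also have "\<dots> = (h ^ s * peer_l c S1 S2 s $ i) *\<^sub>R E s t"
      using order i by (subst sum.lessThan_Suc) simp
    finally show ?thesis .
  qed
  have "uniformly_O T (s + 1) (\<lambda>h t.
      (mat_act (1\<^sub>m s - S2) (\<lambda>k. E 0 (t + c $ k * h)) i - S (\<lambda>j. ((1\<^sub>m s - S2) *\<^sub>v vec_pow c j) $ i) h t)
      - (mat_act S1 (\<lambda>k. E 0 (t + x $ k * h)) i - S (\<lambda>j. (S1 *\<^sub>v vec_pow x j) $ i) h t))"
    by (intro uniformly_O_diff val IS2 mats c x)
  then show ?thesis
  proof (rule uniformly_O_cong, intro always_eventually allI ballI)
    fix h t
    have "mat_act S1 (\<lambda>k. E 0 (t + x $ k * h)) i = mat_act S1 (\<lambda>k. E 0 (t + (c $ k - 1) * h)) i"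
      using mats x by (auto intro!: mat_act_cong)
    then show "(mat_act (1\<^sub>m s - S2) (\<lambda>k. E 0 (t + c $ k * h)) i - S (\<lambda>j. ((1\<^sub>m s - S2) *\<^sub>v vec_pow c j) $ i) h t)
      - (mat_act S1 (\<lambda>k. E 0 (t + x $ k * h)) i - S (\<lambda>j. (S1 *\<^sub>v vec_pow x j) $ i) h t)
      = mat_act (1\<^sub>m s - S2) (\<lambda>k. E 0 (t + c $ k * h)) i
      - mat_act S1 (\<lambda>k. E 0 (t + (c $ k - 1) * h)) i
      - (h ^ s * peer_l c S1 S2 s $ i) *\<^sub>R E s t"
      unfolding collect[symmetric] by (simp add: algebra_simps)
  qed
qed


section \<open>Stability\<close>

lemma discrete_Gronwall:
  fixes y :: "nat \<Rightarrow> real"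
  assumes "\<And>n. n \<le> N \<Longrightarrow> y n \<le> A + \<epsilon> * (\<Sum>k<n. y k)" "\<epsilon> \<ge> 0" "n \<le> N"
  shows "y n \<le> A * (1 + \<epsilon>) ^ n"
  using assms(3)
proof (induction n rule: less_induct)
  case (less n)
  have geometric: "A + \<epsilon> * (\<Sum>k<m. A * (1 + \<epsilon>) ^ k) = A * (1 + \<epsilon>) ^ m" for m
    by (induction m) (auto simp: algebra_simps)
  have "y n \<le> A + \<epsilon> * (\<Sum>k<n. y k)"
    using assms(1) less.prems by blast
  also have "\<dots> \<le> A + \<epsilon> * (\<Sum>k<n. A * (1 + \<epsilon>) ^ k)"
    using less assms(2) by (intro add_left_mono mult_left_mono sum_mono) auto
  finally show ?case
    by (simp only: geometric)
qed

lemma mat_act_pow_Suc: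
  assumes P: "P \<in> carrier_mat s s" and i: "i < s"
  shows "mat_act (P ^\<^sub>m Suc m) w i = mat_act P (mat_act (P ^\<^sub>m m) w) i"
  using i
proof (induction m arbitrary: w i)
  case 0
  then show ?case
    using P by (auto intro!: mat_act_cong simp: mat_act_one)
next
  case (Suc m)
  have pow: "P ^\<^sub>m m \<in> carrier_mat s s" "P ^\<^sub>m Suc m \<in> carrier_mat s s" for m
    using P by (auto intro: pow_carrier_mat)
  have "mat_act (P ^\<^sub>m Suc (Suc m)) w i = mat_act (P ^\<^sub>m Suc m) (mat_act P w) i"
    using mat_act_mult_mat[OF pow(2) P Suc.prems, of m] by simp
  also have "\<dots> = mat_act P (mat_act (P ^\<^sub>m m) (mat_act P w)) i"
    by (rule Suc.IH[OF Suc.prems])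
  also have "\<dots> = mat_act P (mat_act (P ^\<^sub>m Suc m) w) i"
    using P mat_act_mult_mat[OF pow(1) P, of _ _ w] by (intro mat_act_cong) auto
  finally show ?case .
qed

text \<open>
  Variation of constants: with the initial value counted as the perturbation of index \<open>0\<close>, the
  solution is \<open>\<Sum>k\<le>n. P^(n - k) \<delta> k\<close>.
\<close>

lemma power_bounded_recursion:
  assumes P: "P \<in> carrier_mat s s" "power_bounded P"
  obtains K where "K \<ge> 0"
    and "\<And>(x :: nat \<Rightarrow> nat \<Rightarrow> 'v::real_normed_vector) d N n i. \<lbrakk>\<And>i. i < s \<Longrightarrow> norm (x 0 i) \<le> d 0;
      \<And>n i. 1 \<le> n \<Longrightarrow> n \<le> N \<Longrightarrow> i < s \<Longrightarrow> norm (x n i - mat_act P (x (n - 1)) i) \<le> d n; n \<le> N; i < s\<rbrakk>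
      \<Longrightarrow> norm (x n i) \<le> K * (\<Sum>k\<le>n. d k)"
proof -
  have pow: "P ^\<^sub>m m \<in> carrier_mat s s" for m
    using P(1) by (rule pow_carrier_mat)
  obtain K where K: "\<And>n i j. i < s \<Longrightarrow> j < s \<Longrightarrow> \<bar>(P ^\<^sub>m n) $$ (i, j)\<bar> \<le> K"
    using P unfolding power_bounded_def by auto
  define K' where "K' = real s * max 0 K"
  show thesis
  proof (rule that[of K'])
    show "K' \<ge> 0"
      by (simp add: K'_def)
    fix x :: "nat \<Rightarrow> nat \<Rightarrow> 'v" and d N n i
    assume x0: "\<And>i. i < s \<Longrightarrow> norm (x 0 i) \<le> d 0"
      and xn: "\<And>n i. 1 \<le> n \<Longrightarrow> n \<le> N \<Longrightarrow> i < s \<Longrightarrow> norm (x n i - mat_act P (x (n - 1)) i) \<le> d n"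
      and n: "n \<le> N" and i: "i < s"
    define \<delta> where "\<delta> n i = (if n = 0 then x 0 i else x n i - mat_act P (x (n - 1)) i)" for n i
    have \<delta>: "norm (\<delta> k i) \<le> d k" if "k \<le> N" "i < s" for k i
      using x0 xn that by (auto simp: \<delta>_def)
    have "x n i = (\<Sum>k\<le>n. mat_act (P ^\<^sub>m (n - k)) (\<delta> k) i)" if "i < s" for n i
      using that
    proof (induction n arbitrary: i)
      case 0
      then show ?case
        using P(1) by (simp add: \<delta>_def mat_act_one)
    next
      case (Suc n)
      have "x (Suc n) i = mat_act P (x n) i + \<delta> (Suc n) i"
        by (simp add: \<delta>_def)
      also have "mat_act P (x n) i = mat_act P (\<lambda>i. \<Sum>k\<le>n. mat_act (P ^\<^sub>m (n - k)) (\<delta> k) i) i"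
        using P(1) Suc.IH by (intro mat_act_cong) auto
      also have "\<dots> = (\<Sum>k\<le>n. mat_act P (mat_act (P ^\<^sub>m (n - k)) (\<delta> k)) i)"
        by (rule mat_act_sum_right)
      also have "\<dots> = (\<Sum>k\<le>n. mat_act (P ^\<^sub>m (Suc n - k)) (\<delta> k) i)"
        by (intro sum.cong refl) (simp add: Suc_diff_le mat_act_pow_Suc[OF P(1) Suc.prems] del: pow_mat.simps)
      also have "\<dots> + \<delta> (Suc n) i = (\<Sum>k\<le>Suc n. mat_act (P ^\<^sub>m (Suc n - k)) (\<delta> k) i)"
        using P(1) Suc.prems by (simp add: mat_act_one)
      finally show ?case .
    qed
    then have "norm (x n i) \<le> (\<Sum>k\<le>n. norm (mat_act (P ^\<^sub>m (n - k)) (\<delta> k) i))"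
      using i by (simp add: norm_sum)
    also have "\<dots> \<le> (\<Sum>k\<le>n. K' * d k)"
    proof (intro sum_mono)
      fix k assume "k \<in> {..n}"
      then have "k \<le> N"
        using n by auto
      have "norm (mat_act (P ^\<^sub>m (n - k)) (\<delta> k) i) \<le> (real (dim_col (P ^\<^sub>m (n - k))) * max 0 K) * d k"
        using pow[of "n - k"] K i \<delta> \<open>k \<le> N\<close> by (intro norm_mat_act_le) (auto simp: le_max_iff_disj)
      then show "norm (mat_act (P ^\<^sub>m (n - k)) (\<delta> k) i) \<le> K' * d k"
        unfolding K'_def carrier_matD(2)[OF pow] .
    qed
    finally show "norm (x n i) \<le> K' * (\<Sum>k\<le>n. d k)"
      by (simp add: sum_distrib_left)
  qed
qed

lemma norm_le_stage_norm: "i < s \<Longrightarrow> norm (w i) \<le> stage_norm s w"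
  unfolding stage_norm_def by (intro Max_ge) auto

lemma stage_norm_le_iff: "s \<ge> 1 \<Longrightarrow> stage_norm s w \<le> b \<longleftrightarrow> (\<forall>i<s. norm (w i) \<le> b)"
  unfolding stage_norm_def by (subst Max_le_iff) (auto simp: lessThan_empty_iff)

lemma stage_norm_nonneg: "s \<ge> 1 \<Longrightarrow> stage_norm s w \<ge> 0"
  by (rule order_trans[OF norm_ge_zero norm_le_stage_norm[of 0]]) simp

text \<open>
  Zero-stability of the implicit recursion. For \<open>2 K L h \<le> 1\<close> the term of the unknown step is
  absorbed into the left-hand side, which costs the factor \<open>2\<close>, and the remaining sum over
  earlier steps is handled by the discrete Gronwall inequality.
\<close>

lemma stable_recursion_bound:
  assumes P: "P \<in> carrier_mat s s" "power_bounded P" and s: "s \<ge> 1" and L: "L \<ge> 0"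
  obtains C h1 where "C \<ge> 0" "h1 > 0"
    and "\<And>(x :: nat \<Rightarrow> nat \<Rightarrow> 'v::real_normed_vector) h N a b.
      \<lbrakk>0 < h; h \<le> h1; real N * h \<le> T; a \<ge> 0; b \<ge> 0; stage_norm s (x 0) \<le> a;
       \<And>n i. 1 \<le> n \<Longrightarrow> n \<le> N \<Longrightarrow> i < s \<Longrightarrow>
         norm (x n i - mat_act P (x (n - 1)) i) \<le> h * b + h * L * (stage_norm s (x (n - 1)) + stage_norm s (x n))\<rbrakk>
      \<Longrightarrow> stage_norm s (x N) \<le> C * (a + T * b)"
proof -
  obtain K where K: "K \<ge> 0"
    "\<And>(x :: nat \<Rightarrow> nat \<Rightarrow> 'v) d N n i. \<lbrakk>\<And>i. i < s \<Longrightarrow> norm (x 0 i) \<le> d 0;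
      \<And>n i. 1 \<le> n \<Longrightarrow> n \<le> N \<Longrightarrow> i < s \<Longrightarrow> norm (x n i - mat_act P (x (n - 1)) i) \<le> d n; n \<le> N; i < s\<rbrakk>
      \<Longrightarrow> norm (x n i) \<le> K * (\<Sum>k\<le>n. d k)"
    by (rule power_bounded_recursion[OF P]) blast
  define h1 where "h1 = 1 / (2 * K * L + 1)"
  have "h1 > 0"
    using K(1) L by (auto simp: h1_def add_nonneg_pos)
  show thesis
  proof (rule that[of "2 * K * exp (4 * K * L * T)" h1])
    show "2 * K * exp (4 * K * L * T) \<ge> 0"
      using K(1) by simp
    show "h1 > 0" by fact
    fix x :: "nat \<Rightarrow> nat \<Rightarrow> 'v" and h N a b
    assume h: "0 < h" "h \<le> h1" "real N * h \<le> T" and ab: "a \<ge> 0" "b \<ge> 0"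
      and x0: "stage_norm s (x 0) \<le> a"
      and rec: "\<And>n i. 1 \<le> n \<Longrightarrow> n \<le> N \<Longrightarrow> i < s \<Longrightarrow>
         norm (x n i - mat_act P (x (n - 1)) i) \<le> h * b + h * L * (stage_norm s (x (n - 1)) + stage_norm s (x n))"
    define y where "y n = stage_norm s (x n)" for n
    have y_nonneg: "y n \<ge> 0" for n
      unfolding y_def by (rule stage_norm_nonneg[OF s])
    define d where "d n = (if n = 0 then a else h * b + h * L * (y (n - 1) + y n))" for n
    have "2 * K * L * h \<le> 2 * K * L * h1"
      using h K L by (intro mult_left_mono) auto
    also have "\<dots> \<le> 1"
    proof -
      have "2 * K * L \<ge> 0"
        using K(1) L by simp
      then show ?thesis
        by (auto simp: h1_def divide_le_eq_1)
    qed
    finally have half: "K * (h * L) \<le> 1 / 2"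
      by (simp add: mult_ac)
    have sum_d: "(\<Sum>k\<le>n. d k) \<le> a + real n * (h * b) + h * L * (2 * (\<Sum>k<n. y k) + y n)" for n
    proof (induction n)
      case 0
      then show ?case
        using y_nonneg h L by (simp add: d_def)
    next
      case (Suc n)
      then show ?case
        by (simp add: d_def algebra_simps)
    qed
    have step: "y n \<le> 2 * K * (a + T * b) + (4 * K * L * h) * (\<Sum>k<n. y k)" if n: "n \<le> N" for n
    proof -
      have "norm (x n i) \<le> K * (\<Sum>k\<le>n. d k)" if "i < s" for i
      proof (rule K(2)[where N = N])
        show "norm (x 0 i) \<le> d 0" if "i < s" for i
          using x0 norm_le_stage_norm[OF that, of "x 0"] by (simp add: d_def)
        show "norm (x m j - mat_act P (x (m - 1)) j) \<le> d m" if "1 \<le> m" "m \<le> N" "j < s" for m j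
          using rec[OF that] that by (simp add: d_def y_def)
      qed (use n that in auto)
      then have "y n \<le> K * (\<Sum>k\<le>n. d k)"
        unfolding y_def using stage_norm_le_iff[OF s] by blast
      also have "\<dots> \<le> K * (a + T * b + h * L * (2 * (\<Sum>k<n. y k) + y n))"
      proof -
        have "real n * h * b \<le> T * b"
          using h n ab by (intro mult_right_mono order_trans[OF _ h(3)]) auto
        then show ?thesis
          using sum_d[of n] K(1) by (intro mult_left_mono) (auto simp: mult_ac)
      qed
      also have "\<dots> = K * (a + T * b) + 2 * (K * (h * L)) * (\<Sum>k<n. y k) + K * (h * L) * y n"
        by (simp add: algebra_simps)
      also have "\<dots> \<le> K * (a + T * b) + 2 * (K * (h * L)) * (\<Sum>k<n. y k) + 1 / 2 * y n"
        using half y_nonneg by (intro add_left_mono mult_right_mono) auto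
      finally show ?thesis
        by (simp add: algebra_simps)
    qed
    have eps: "4 * K * L * h \<ge> 0"
      using K L h by simp
    have T: "T \<ge> 0"
      using h by (meson mult_nonneg_nonneg of_nat_0_le_iff order_less_imp_le order_trans)
    have "y N \<le> 2 * K * (a + T * b) * (1 + 4 * K * L * h) ^ N"
      by (rule discrete_Gronwall[OF step eps]) auto
    also have "\<dots> \<le> 2 * K * (a + T * b) * exp (4 * K * L * T)"
    proof (intro mult_left_mono)
      have "(1 + 4 * K * L * h) ^ N \<le> exp (4 * K * L * h) ^ N"
        using eps by (intro power_mono exp_ge_add_one_self) auto
      also have "\<dots> = exp (4 * K * L * (real N * h))"
        by (simp add: exp_of_nat_mult[symmetric] mult_ac)
      also have "\<dots> \<le> exp (4 * K * L * T)"
        using h K L by (auto intro!: mult_left_mono)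
      finally show "(1 + 4 * K * L * h) ^ N \<le> exp (4 * K * L * T)" .
      show "0 \<le> 2 * K * (a + T * b)"
        using K ab T by auto
    qed
    finally show "stage_norm s (x N) \<le> 2 * K * exp (4 * K * L * T) * (a + T * b)"
      by (simp add: y_def algebra_simps)
  qed
qed


section \<open>The IMEX-Peer method\<close>

definition imex_rhs ::
  "real Matrix.mat \<Rightarrow> real Matrix.mat \<Rightarrow> real Matrix.mat \<Rightarrow> real Matrix.mat \<Rightarrow> real Matrix.mat \<Rightarrow>
   ('v::real_vector \<Rightarrow> 'v) \<Rightarrow> ('v \<Rightarrow> 'v) \<Rightarrow> real \<Rightarrow> (nat \<Rightarrow> 'v) \<Rightarrow> (nat \<Rightarrow> 'v) \<Rightarrow> nat \<Rightarrow> 'v"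
where
  "imex_rhs P Q R Qhat Rhat F0 F1 h v w i = mat_act P v i
     + h *\<^sub>R mat_act Qhat (\<lambda>j. F0 (v j)) i + h *\<^sub>R mat_act Rhat (\<lambda>j. F0 (w j)) i
     + h *\<^sub>R mat_act Q (\<lambda>j. F1 (v j)) i + h *\<^sub>R mat_act R (\<lambda>j. F1 (w j)) i"

definition imex_residual where
  "imex_residual c P Q R Qhat Rhat F0 F1 u h t i = u (t + c $ i * h)
     - imex_rhs P Q R Qhat Rhat F0 F1 h (\<lambda>k. u (t + (c $ k - 1) * h)) (\<lambda>k. u (t + c $ k * h)) i"

text \<open>
  The IMEX method differs from the implicit one only in replacing \<open>F\<^sub>0(w\<^sub>n)\<close> by the extrapolation
  \<open>S\<^sub>2 F\<^sub>0(w\<^sub>n) + S\<^sub>1 F\<^sub>0(w\<^sub>n\<^sub>-\<^sub>1)\<close>, so the residuals differ by \<open>h R\<close> times the extrapolation error.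
  Along the solution, \<open>F\<^sub>0(u) + F\<^sub>1(u) = u'\<close> removes the right-hand sides from the implicit residual.
\<close>

lemma imex_residual_split:
  assumes mats: "P \<in> carrier_mat s s" "Q \<in> carrier_mat s s" "R \<in> carrier_mat s s"
      "S1 \<in> carrier_mat s s" "S2 \<in> carrier_mat s s" and i: "i < s"
    and u': "\<And>k. k < s \<Longrightarrow> u' (t + (c $ k - 1) * h) = F0 (u (t + (c $ k - 1) * h)) + F1 (u (t + (c $ k - 1) * h))"
      "\<And>k. k < s \<Longrightarrow> u' (t + c $ k * h) = F0 (u (t + c $ k * h)) + F1 (u (t + c $ k * h))"
  shows "imex_residual c P Q R (Q + R * S1) (R * S2) F0 F1 u h t i =
      (u (t + c $ i * h) - mat_act P (\<lambda>k. u (t + (c $ k - 1) * h)) i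
        - h *\<^sub>R mat_act Q (\<lambda>k. u' (t + (c $ k - 1) * h)) i - h *\<^sub>R mat_act R (\<lambda>k. u' (t + c $ k * h)) i)
      + h *\<^sub>R mat_act R (\<lambda>k. mat_act (1\<^sub>m s - S2) (\<lambda>k. F0 (u (t + c $ k * h))) k
          - mat_act S1 (\<lambda>k. F0 (u (t + (c $ k - 1) * h))) k) i"
proof -
  define v where "v k = u (t + (c $ k - 1) * h)" for k
  define w where "w k = u (t + c $ k * h)" for k
  have Q_u': "mat_act Q (\<lambda>k. u' (t + (c $ k - 1) * h)) i
      = mat_act Q (\<lambda>k. F0 (v k)) i + mat_act Q (\<lambda>k. F1 (v k)) i"
    using mats u' by (subst mat_act_add_right[symmetric], intro mat_act_cong) (auto simp: v_def)
  have R_u': "mat_act R (\<lambda>k. u' (t + c $ k * h)) i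
      = mat_act R (\<lambda>k. F0 (w k)) i + mat_act R (\<lambda>k. F1 (w k)) i"
    using mats u' by (subst mat_act_add_right[symmetric], intro mat_act_cong) (auto simp: w_def)
  have Qhat: "mat_act (Q + R * S1) x i = mat_act Q x i + mat_act R (mat_act S1 x) i" for x :: "nat \<Rightarrow> 'a"
    using mat_act_add_mat[OF mats(2) mult_carrier_mat[OF mats(3,4)] i] mat_act_mult_mat[OF mats(3,4) i] by metis
  have Rhat: "mat_act (R * S2) x i = mat_act R (mat_act S2 x) i" for x :: "nat \<Rightarrow> 'a"
    by (rule mat_act_mult_mat[OF mats(3,5) i])
  have ext: "mat_act R (\<lambda>k. mat_act (1\<^sub>m s - S2) x k - mat_act S1 y k) i
      = mat_act R x i - mat_act R (mat_act S2 x) i - mat_act R (mat_act S1 y) i" for x y :: "nat \<Rightarrow> 'a"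
  proof -
    have "mat_act R (\<lambda>k. mat_act (1\<^sub>m s - S2) x k - mat_act S1 y k) i
        = mat_act R (\<lambda>k. (x k - mat_act S2 x k) - mat_act S1 y k) i"
      using mats by (intro mat_act_cong) (simp add: mat_act_diff_mat[OF one_carrier_mat mats(5)] mat_act_one)
    then show ?thesis
      by (simp only: mat_act_diff_right)
  qed
  show ?thesis
    unfolding imex_residual_def imex_rhs_def Qhat Rhat Q_u' R_u' ext v_def[symmetric] w_def[symmetric]
    by (simp add: algebra_simps)
qed

lemma vector_in_range_of_I_minus:
  assumes "P \<in> carrier_mat s s" "v \<in> mat_range (1\<^sub>m s - P)"
  obtains a where "a \<in> carrier_vec s" "\<And>i. i < s \<Longrightarrow> v $ i = a $ i - (P *\<^sub>v a) $ i"
proof -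
  obtain a where a: "a \<in> carrier_vec s" "v = (1\<^sub>m s - P) *\<^sub>v a"
    using assms by (auto simp: mat_range_def)
  have "v $ i = a $ i - (P *\<^sub>v a) $ i" if "i < s" for i
    using assms(1) a that minus_mult_distrib_mat_vec[of "1\<^sub>m s" s s P a] by simp
  with a(1) show thesis
    by (rule that)
qed

text \<open>
  The leading coefficients \<open>d\<^sub>s\<^sub>+\<^sub>1\<close> and \<open>R l\<^sub>s\<close> of the residual lie in the range of \<open>I - P\<close>. With
  preimages \<open>a\<close> and \<open>b\<close>, the function \<open>g = a u\<^bsup>(s+1)\<^esup> + b (F\<^sub>0 u)\<^bsup>(s)\<^esup>\<close> turns the leading term into
  \<open>g t - P g t\<close>. Replacing the second \<open>g t\<close> by \<open>g (t - h)\<close> changes it by \<open>O(h)\<close> only and makes the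
  sum over the steps telescope.
\<close>

lemma imex_residual_telescopes:
  fixes F0 F1 :: "'v::euclidean_space \<Rightarrow> 'v"
  assumes J: "T > 0" "open J" "is_interval J" "{0..T} \<subseteq> J"
    and F0: "Ck_on (s + 1) F0 UNIV" and u: "Ck_on (s + 2) u J"
    and ode: "\<And>t. t \<in> J \<Longrightarrow> (u has_vector_derivative F0 (u t) + F1 (u t)) (at t)"
    and c: "c \<in> carrier_vec s" "\<And>i j. i < s \<Longrightarrow> j < s \<Longrightarrow> i \<noteq> j \<Longrightarrow> c $ i \<noteq> c $ j"
    and mats: "P \<in> carrier_mat s s" "Q \<in> carrier_mat s s" "R \<in> carrier_mat s s" "S2 \<in> carrier_mat s s"
    and S1: "S1 = peer_S1 c S2"
    and order: "stage_order c P Q R s"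
    and range_d: "peer_d c P Q R (s + 1) \<in> mat_range (1\<^sub>m s - P)"
    and range_l: "R *\<^sub>v peer_l c S1 S2 s \<in> mat_range (1\<^sub>m s - P)"
  obtains g where "\<And>i. i < s \<Longrightarrow> uniformly_O T 0 (\<lambda>_ t. g t i)"
    and "\<And>i. i < s \<Longrightarrow> uniformly_O T (s + 2) (\<lambda>h t. imex_residual c P Q R (Q + R * S1) (R * S2) F0 F1 u h t i
      - h ^ (s + 1) *\<^sub>R (g t i - mat_act P (g (t - h)) i))"
proof -
  note S1_exact = peer_S1_exact[OF c mats(4), folded S1]
  obtain D where D: "D 0 = u" "\<And>j t. j < s + 2 \<Longrightarrow> t \<in> J \<Longrightarrow> (D j has_vector_derivative D (Suc j) t) (at t)"
    "\<And>j. j \<le> s + 2 \<Longrightarrow> continuous_on J (D j)"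
    using Ck_on_derivative_sequence[OF u] by blast
  have "Ck_on (s + 1) (\<lambda>t. F0 (u t)) J"
    by (rule Ck_on_compose[OF J(2) F0 Ck_on_le[OF u]]) simp
  then obtain E where E: "E 0 = (\<lambda>t. F0 (u t))"
    "\<And>j t. j < s + 1 \<Longrightarrow> t \<in> J \<Longrightarrow> (E j has_vector_derivative E (Suc j) t) (at t)"
    "\<And>j. j \<le> s + 1 \<Longrightarrow> continuous_on J (E j)"
    using Ck_on_derivative_sequence by blast
  have D1: "D 1 t = F0 (u t) + F1 (u t)" if "t \<in> J" for t
    using vector_derivative_unique_at[OF _ ode[OF that]] D(1) D(2)[of 0 t] that by simp
  obtain a where a: "a \<in> carrier_vec s" "\<And>i. i < s \<Longrightarrow> peer_d c P Q R (s + 1) $ i = a $ i - (P *\<^sub>v a) $ i"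
    by (rule vector_in_range_of_I_minus[OF mats(1) range_d]) blast
  obtain b where b: "b \<in> carrier_vec s" "\<And>i. i < s \<Longrightarrow> (R *\<^sub>v peer_l c S1 S2 s) $ i = b $ i - (P *\<^sub>v b) $ i"
    by (rule vector_in_range_of_I_minus[OF mats(1) range_l]) blast
  define g where "g t i = (a $ i) *\<^sub>R D (s + 1) t + (b $ i) *\<^sub>R E s t" for t i
  obtain e where e: "e > 0" "{-e..T + e} \<subseteq> J"
    using interval_neighbourhood[OF J] .
  have nodes_in_J: "\<forall>\<^sub>F h in at_right 0. \<forall>t\<in>{0..T}. \<forall>k<s. t + (c $ k - 1) * h \<in> J \<and> t + c $ k * h \<in> J"
  proof -
    have "\<forall>\<^sub>F h in at_right 0. \<forall>k\<in>{..<s}. (\<forall>t\<in>{0..T}. t + (c $ k - 1) * h \<in> {-e..T + e})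
        \<and> (\<forall>t\<in>{0..T}. t + c $ k * h \<in> {-e..T + e})"
      by (intro eventually_ball_finite ballI eventually_conj eventually_shifted_in_interval e) auto
    then show ?thesis
      by eventually_elim (use e(2) in blast)
  qed
  have leading: "uniformly_O T (s + 2) (\<lambda>h t. imex_residual c P Q R (Q + R * S1) (R * S2) F0 F1 u h t i
      - h ^ (s + 1) *\<^sub>R (g t i - mat_act P (g t) i))" if i: "i < s" for i
  proof -
    define X where "X h t = u (t + c $ i * h) - mat_act P (\<lambda>k. u (t + (c $ k - 1) * h)) i
        - h *\<^sub>R mat_act Q (\<lambda>k. D 1 (t + (c $ k - 1) * h)) i - h *\<^sub>R mat_act R (\<lambda>k. D 1 (t + c $ k * h)) i" for h t
    define Y where "Y h t k = mat_act (1\<^sub>m s - S2) (\<lambda>k. F0 (u (t + c $ k * h))) k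
        - mat_act S1 (\<lambda>k. F0 (u (t + (c $ k - 1) * h))) k" for h t k
    have X: "uniformly_O T (s + 2) (\<lambda>h t. X h t - (h ^ (s + 1) * peer_d c P Q R (s + 1) $ i) *\<^sub>R D (s + 1) t)"
      unfolding X_def D(1)[symmetric]
      by (rule implicit_residual_expansion[OF J D(2) D(3)[OF order_refl] c(1) mats(1-3) order i])
    have "uniformly_O T (s + 1) (\<lambda>h t. Y h t k - (h ^ s * peer_l c S1 S2 s $ k) *\<^sub>R E s t)" if "k < s" for k
      using extrapolation_expansion[OF J E(2) E(3)[OF order_refl] c(1) S1_exact(1) mats(4) S1_exact(2) that]
      unfolding Y_def E(1) by simp
    then have "uniformly_O T (s + 1) (\<lambda>h t. mat_act R (\<lambda>k. Y h t k - (h ^ s * peer_l c S1 S2 s $ k) *\<^sub>R E s t) i)"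
      using mats(3) by (intro uniformly_O_mat_act) auto
    from uniformly_O_power_mult[OF this, of 1]
    have RY: "uniformly_O T (s + 2) (\<lambda>h t. h *\<^sub>R mat_act R (\<lambda>k. Y h t k - (h ^ s * peer_l c S1 S2 s $ k) *\<^sub>R E s t) i)"
      by simp
    have l: "peer_l c S1 S2 s \<in> carrier_vec s"
      using S1_exact(1) by (intro carrier_vecI) (simp add: peer_l_def carrier_matD)
    have RY_eq: "mat_act R (\<lambda>k. Y h t k - (h ^ s * peer_l c S1 S2 s $ k) *\<^sub>R E s t) i
        = mat_act R (Y h t) i - (h ^ s * (R *\<^sub>v peer_l c S1 S2 s) $ i) *\<^sub>R E s t" for h t
      using mat_act_scaled_vector[OF mats(3) l i, of "E s t"]
      by (simp add: mat_act_diff_right mat_act_scaleR_right scaleR_scaleR[symmetric] del: scaleR_scaleR)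
    have P_g: "mat_act P (g t) i = ((P *\<^sub>v a) $ i) *\<^sub>R D (s + 1) t + ((P *\<^sub>v b) $ i) *\<^sub>R E s t" for t
      unfolding g_def using mat_act_scaled_vector[OF mats(1) a(1) i, of "D (s + 1) t"]
        mat_act_scaled_vector[OF mats(1) b(1) i, of "E s t"]
      by (simp add: mat_act_add_right)
    show ?thesis
    proof (rule uniformly_O_cong[OF uniformly_O_add[OF X RY]])
      show "\<forall>\<^sub>F h in at_right 0. \<forall>t\<in>{0..T}.
          X h t - (h ^ (s + 1) * peer_d c P Q R (s + 1) $ i) *\<^sub>R D (s + 1) t
            + h *\<^sub>R mat_act R (\<lambda>k. Y h t k - (h ^ s * peer_l c S1 S2 s $ k) *\<^sub>R E s t) i
          = imex_residual c P Q R (Q + R * S1) (R * S2) F0 F1 u h t i - h ^ (s + 1) *\<^sub>R (g t i - mat_act P (g t) i)"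
        using nodes_in_J
      proof eventually_elim
        case (elim h)
        show ?case
        proof
          fix t assume t: "t \<in> {0..T}"
          have "imex_residual c P Q R (Q + R * S1) (R * S2) F0 F1 u h t i = X h t + h *\<^sub>R mat_act R (Y h t) i"
            unfolding X_def Y_def using elim t
            by (intro imex_residual_split[OF mats(1-3) S1_exact(1) mats(4) i] D1) auto
          then show "X h t - (h ^ (s + 1) * peer_d c P Q R (s + 1) $ i) *\<^sub>R D (s + 1) t
            + h *\<^sub>R mat_act R (\<lambda>k. Y h t k - (h ^ s * peer_l c S1 S2 s $ k) *\<^sub>R E s t) i
            = imex_residual c P Q R (Q + R * S1) (R * S2) F0 F1 u h t i - h ^ (s + 1) *\<^sub>R (g t i - mat_act P (g t) i)"
            unfolding RY_eq P_g a(2)[OF i] b(2)[OF i] g_def by (simp add: algebra_simps)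
        qed
      qed
    qed
  qed
  have shift: "uniformly_O T 1 (\<lambda>h t. g (t - h) k - g t k)" for k
  proof -
    have 1: "uniformly_O T 1 (\<lambda>h t. D (s + 1) (t - h) - D (s + 1) t)"
      using Taylor_uniformly_O[OF J, where D = "\<lambda>j. D (s + 1 + j)" and p = 1 and \<alpha> = "-1"] D(2,3) by simp
    have 2: "uniformly_O T 1 (\<lambda>h t. E s (t - h) - E s t)"
      using Taylor_uniformly_O[OF J, where D = "\<lambda>j. E (s + j)" and p = 1 and \<alpha> = "-1"] E(2,3) by simp
    show ?thesis
      using uniformly_O_add[OF uniformly_O_scaleR[OF 1, of "a $ k"] uniformly_O_scaleR[OF 2, of "b $ k"]]
      by (simp add: g_def algebra_simps)
  qed
  have "uniformly_O T (s + 2) (\<lambda>h t. imex_residual c P Q R (Q + R * S1) (R * S2) F0 F1 u h t i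
      - h ^ (s + 1) *\<^sub>R (g t i - mat_act P (g (t - h)) i))" if i: "i < s" for i
  proof -
    have "uniformly_O T (s + 1 + 1) (\<lambda>h t. h ^ (s + 1) *\<^sub>R mat_act P (\<lambda>k. g (t - h) k - g t k) i)"
      by (intro uniformly_O_power_mult uniformly_O_mat_act shift)
    from uniformly_O_add[OF leading[OF i] this[unfolded add.assoc one_add_one]] show ?thesis
      by (simp add: mat_act_diff_right algebra_simps)
  qed
  moreover have "uniformly_O T 0 (\<lambda>_ t. g t k)" for k
  proof -
    have 1: "uniformly_O T 0 (\<lambda>_ t. D (s + 1) t)"
      using Taylor_uniformly_O[OF J, where D = "\<lambda>_. D (s + 1)" and p = 0 and \<alpha> = 0] D(3) by simp
    have 2: "uniformly_O T 0 (\<lambda>_ t. E s t)"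
      using Taylor_uniformly_O[OF J, where D = "\<lambda>_. E s" and p = 0 and \<alpha> = 0] E(3) by simp
    show ?thesis
      unfolding g_def by (intro uniformly_O_add uniformly_O_scaleR 1 2)
  qed
  ultimately show thesis
    by (intro that[of g]) auto
qed

text \<open>
  Apart from the term with \<open>P\<close>, every term carries a factor \<open>h\<close> and a function that is Lipschitz
  on bounded sets. The ball is fixed in advance, so that \<open>M\<close> is independent of \<open>h\<close>.
\<close>

lemma imex_rhs_Lipschitz:
  fixes F0 F1 :: "'v::euclidean_space \<Rightarrow> 'v"
  assumes mats: "P \<in> carrier_mat s s" "Q \<in> carrier_mat s s" "R \<in> carrier_mat s s"
      "Qhat \<in> carrier_mat s s" "Rhat \<in> carrier_mat s s"
    and smooth: "Ck_on 1 F0 UNIV" "Ck_on 1 F1 UNIV" and s: "s \<ge> 1"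
  obtains M where "M \<ge> 0"
    and "\<And>h v w v' w' i. \<lbrakk>0 \<le> h; i < s; \<And>k. k < s \<Longrightarrow> v k \<in> cball 0 r \<and> w k \<in> cball 0 r \<and> v' k \<in> cball 0 r \<and> w' k \<in> cball 0 r\<rbrakk>
      \<Longrightarrow> norm (imex_rhs P Q R Qhat Rhat F0 F1 h v w i - imex_rhs P Q R Qhat Rhat F0 F1 h v' w' i
          - mat_act P (\<lambda>k. v k - v' k) i)
        \<le> h * M * (stage_norm s (\<lambda>k. v k - v' k) + stage_norm s (\<lambda>k. w k - w' k))"
proof -
  have bound: "\<exists>M\<ge>0. \<forall>v v' i. i < s \<longrightarrow> (\<forall>k<s. v k \<in> cball 0 r \<and> v' k \<in> cball 0 r) \<longrightarrow>
      norm (mat_act A (\<lambda>k. F (v k)) i - mat_act A (\<lambda>k. F (v' k)) i) \<le> M * stage_norm s (\<lambda>k. v k - v' k)"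
    if A: "A \<in> carrier_mat s s" and F: "Ck_on 1 F UNIV" for A and F :: "'v \<Rightarrow> 'v"
  proof -
    obtain L where L: "L \<ge> 0" "\<And>x y. x \<in> cball 0 r \<Longrightarrow> y \<in> cball 0 r \<Longrightarrow> norm (F x - F y) \<le> L * norm (x - y)"
      using C1_Lipschitz_on_cball[OF F] by blast
    obtain K where K: "K \<ge> 0" "\<And>(w :: nat \<Rightarrow> 'v) b i. i < s \<Longrightarrow> (\<And>k. k < s \<Longrightarrow> norm (w k) \<le> b) \<Longrightarrow> norm (mat_act A w i) \<le> K * b"
      using mat_act_bounded[OF A] by blast
    have "norm (mat_act A (\<lambda>k. F (v k)) i - mat_act A (\<lambda>k. F (v' k)) i) \<le> (K * L) * stage_norm s (\<lambda>k. v k - v' k)"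
      if i: "i < s" and "\<forall>k<s. v k \<in> cball 0 r \<and> v' k \<in> cball 0 r" for v v' i
    proof -
      have "norm (F (v k) - F (v' k)) \<le> L * stage_norm s (\<lambda>k. v k - v' k)" if "k < s" for k
        using L \<open>\<forall>k<s. v k \<in> cball 0 r \<and> v' k \<in> cball 0 r\<close> that norm_le_stage_norm[OF that, of "\<lambda>k. v k - v' k"]
        by (intro order_trans[OF L(2)] mult_left_mono) auto
      from K(2)[OF i this] show ?thesis
        by (simp add: mat_act_diff_right mult.assoc)
    qed
    with K(1) L(1) show ?thesis
      by (intro exI[of _ "K * L"]) auto
  qed
  obtain M1 where M1: "M1 \<ge> 0" "\<And>v v' i. i < s \<Longrightarrow> (\<forall>k<s. v k \<in> cball 0 r \<and> v' k \<in> cball 0 r) \<Longrightarrow>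
      norm (mat_act Qhat (\<lambda>k. F0 (v k)) i - mat_act Qhat (\<lambda>k. F0 (v' k)) i) \<le> M1 * stage_norm s (\<lambda>k. v k - v' k)"
    using bound[OF mats(4) smooth(1)] by blast
  obtain M2 where M2: "M2 \<ge> 0" "\<And>v v' i. i < s \<Longrightarrow> (\<forall>k<s. v k \<in> cball 0 r \<and> v' k \<in> cball 0 r) \<Longrightarrow>
      norm (mat_act Rhat (\<lambda>k. F0 (v k)) i - mat_act Rhat (\<lambda>k. F0 (v' k)) i) \<le> M2 * stage_norm s (\<lambda>k. v k - v' k)"
    using bound[OF mats(5) smooth(1)] by blast
  obtain M3 where M3: "M3 \<ge> 0" "\<And>v v' i. i < s \<Longrightarrow> (\<forall>k<s. v k \<in> cball 0 r \<and> v' k \<in> cball 0 r) \<Longrightarrow>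
      norm (mat_act Q (\<lambda>k. F1 (v k)) i - mat_act Q (\<lambda>k. F1 (v' k)) i) \<le> M3 * stage_norm s (\<lambda>k. v k - v' k)"
    using bound[OF mats(2) smooth(2)] by blast
  obtain M4 where M4: "M4 \<ge> 0" "\<And>v v' i. i < s \<Longrightarrow> (\<forall>k<s. v k \<in> cball 0 r \<and> v' k \<in> cball 0 r) \<Longrightarrow>
      norm (mat_act R (\<lambda>k. F1 (v k)) i - mat_act R (\<lambda>k. F1 (v' k)) i) \<le> M4 * stage_norm s (\<lambda>k. v k - v' k)"
    using bound[OF mats(3) smooth(2)] by blast
  define M where "M = M1 + M2 + M3 + M4"
  show thesis
  proof (rule that[of M])
    show "M \<ge> 0"
      using M1 M2 M3 M4 by (simp add: M_def)
    fix h :: real and v w v' w' :: "nat \<Rightarrow> 'v" and i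
    assume h: "0 \<le> h" and i: "i < s"
      and ball: "\<And>k. k < s \<Longrightarrow> v k \<in> cball 0 r \<and> w k \<in> cball 0 r \<and> v' k \<in> cball 0 r \<and> w' k \<in> cball 0 r"
    define nv where "nv = stage_norm s (\<lambda>k. v k - v' k)"
    define nw where "nw = stage_norm s (\<lambda>k. w k - w' k)"
    define A1 where "A1 = mat_act Qhat (\<lambda>k. F0 (v k)) i - mat_act Qhat (\<lambda>k. F0 (v' k)) i"
    define A2 where "A2 = mat_act Rhat (\<lambda>k. F0 (w k)) i - mat_act Rhat (\<lambda>k. F0 (w' k)) i"
    define A3 where "A3 = mat_act Q (\<lambda>k. F1 (v k)) i - mat_act Q (\<lambda>k. F1 (v' k)) i"
    define A4 where "A4 = mat_act R (\<lambda>k. F1 (w k)) i - mat_act R (\<lambda>k. F1 (w' k)) i"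
    have nonneg: "nv \<ge> 0" "nw \<ge> 0"
      using stage_norm_nonneg[OF s] by (simp_all add: nv_def nw_def)
    have bounds: "norm A1 \<le> M1 * nv" "norm A2 \<le> M2 * nw" "norm A3 \<le> M3 * nv" "norm A4 \<le> M4 * nw"
      unfolding A1_def A2_def A3_def A4_def nv_def nw_def
      using M1(2)[OF i] M2(2)[OF i] M3(2)[OF i] M4(2)[OF i] ball by auto
    have larger: "M1 * nv \<le> M1 * (nv + nw)" "M2 * nw \<le> M2 * (nv + nw)"
        "M3 * nv \<le> M3 * (nv + nw)" "M4 * nw \<le> M4 * (nv + nw)"
      using nonneg M1 M2 M3 M4 by (auto intro!: mult_left_mono)
    have "norm (A1 + A2 + A3 + A4) \<le> norm A1 + norm A2 + norm A3 + norm A4"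
      by (intro norm_triangle_le add_right_mono) simp
    also have "\<dots> \<le> M * (nv + nw)"
      using bounds larger unfolding M_def distrib_right by linarith
    finally have "norm (h *\<^sub>R (A1 + A2 + A3 + A4)) \<le> h * (M * (nv + nw))"
      using h by (simp add: mult_left_mono)
    moreover have "imex_rhs P Q R Qhat Rhat F0 F1 h v w i - imex_rhs P Q R Qhat Rhat F0 F1 h v' w' i
          - mat_act P (\<lambda>k. v k - v' k) i = h *\<^sub>R (A1 + A2 + A3 + A4)"
      by (simp add: imex_rhs_def mat_act_diff_right A1_def A2_def A3_def A4_def algebra_simps)
    ultimately show "norm (imex_rhs P Q R Qhat Rhat F0 F1 h v w i - imex_rhs P Q R Qhat Rhat F0 F1 h v' w' i
          - mat_act P (\<lambda>k. v k - v' k) i)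
        \<le> h * M * (stage_norm s (\<lambda>k. v k - v' k) + stage_norm s (\<lambda>k. w k - w' k))"
      by (simp add: nv_def nw_def mult.assoc)
  qed
qed

text \<open>
  The sum of the norms over the stages is again of the same order and dominates each of them.
\<close>

lemma uniformly_O_common_constant:
  fixes s :: nat
  assumes "\<And>i. i < s \<Longrightarrow> uniformly_O T p (\<lambda>h t. r h t i)"
  obtains C where "C \<ge> 0" "\<forall>\<^sub>F h in at_right 0. \<forall>t\<in>{0..T}. \<forall>i<s. norm (r h t i) \<le> C * h ^ p"
proof -
  have "uniformly_O T p (\<lambda>h t. norm (r h t i))" if "i < s" for i
    using assms[OF that] by (simp add: uniformly_O_def)
  then have "uniformly_O T p (\<lambda>h t. \<Sum>i<s. norm (r h t i))"
    by (intro uniformly_O_sum) auto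
  then obtain C where "\<forall>\<^sub>F h in at_right 0. \<forall>t\<in>{0..T}. norm (\<Sum>i<s. norm (r h t i)) \<le> C * h ^ p"
    by (auto simp: uniformly_O_def)
  then have "\<forall>\<^sub>F h in at_right 0. \<forall>t\<in>{0..T}. \<forall>i<s. norm (r h t i) \<le> max 0 C * h ^ p"
    using eventually_pos_at_right_0
  proof eventually_elim
    case (elim h)
    show ?case
    proof (intro ballI allI impI)
      fix t i assume t: "t \<in> {0..T}" and i: "i < s"
      have "norm (r h t i) \<le> (\<Sum>i<s. norm (r h t i))"
        using i by (intro member_le_sum) auto
      also have "\<dots> \<le> C * h ^ p"
        using elim(1) t by fastforce
      also have "\<dots> \<le> max 0 C * h ^ p"
        using elim(2) by (intro mult_right_mono) auto
      finally show "norm (r h t i) \<le> max 0 C * h ^ p" .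
    qed
  qed
  then show thesis
    by (intro that[of "max 0 C"]) auto
qed

theorem theorem2p5:
  fixes s :: nat
    and c :: "real Matrix.vec"
    and P Q R S1 S2 Qhat Rhat :: "real Matrix.mat"
    and F0 F1 :: "real ^ 'm \<Rightarrow> real ^ 'm"
    and u :: "real \<Rightarrow> real ^ 'm"
    and u0 :: "real ^ 'm"
    and J :: "real set"
    and T :: real
    and W :: "real \<Rightarrow> nat \<Rightarrow> nat \<Rightarrow> real ^ 'm"
  assumes peer: "implicit_peer s c P Q R"
    and Q: "Q = peer_Q c P R"
    and stable: "zero_stable P"
    and order: "stage_order c P Q R s"
    and S2: "S2 \<in> carrier_mat s s" "strictly_lower_triangular S2"
    and S1: "S1 = peer_S1 c S2"
    and Rhat: "Rhat = R * S2"
    and Qhat: "Qhat = Q + R * S1"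
    and smooth: "Ck_on (s + 1) F0 UNIV" "Ck_on (s + 1) F1 UNIV"
    and T: "T > 0"
    and J: "open J" "is_interval J" "{0..T} \<subseteq> J"
    and u: "ivp_solution F0 F1 u0 J u" "Ck_on (s + 2) u J"
    and W: "imex_peer_solution c P Q R Qhat Rhat F0 F1 u T W"
    and conv: "convergent_of_order c u T W s"
    and init: "initial_values_of_order c u W (s + 1)"
    and range_d: "peer_d c P Q R (s + 1) \<in> mat_range (1\<^sub>m s - P)"
    and range_l: "R *\<^sub>v peer_l c S1 S2 s \<in> mat_range (1\<^sub>m s - P)"
  shows "convergent_of_order c u T W (s + 1)"
proof -
  have s: "s \<ge> 1" and c: "c \<in> carrier_vec s" and P: "P \<in> carrier_mat s s"
    and Q_mat: "Q \<in> carrier_mat s s" and R: "R \<in> carrier_mat s s"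
    and distinct: "\<And>i j. i < s \<Longrightarrow> j < s \<Longrightarrow> i \<noteq> j \<Longrightarrow> c $ i \<noteq> c $ j"
    using peer by (auto simp: implicit_peer_def)
  have dim: "dim_vec c = s"
    using c by simp
  have S1_mat: "S1 \<in> carrier_mat s s"
    unfolding S1 by (rule peer_S1_exact(1)[OF c distinct S2(1)])
  have hats: "Qhat \<in> carrier_mat s s" "Rhat \<in> carrier_mat s s"
    using Q_mat R S1_mat S2(1) by (auto simp: Qhat Rhat)
  have ode: "(u has_vector_derivative F0 (u t) + F1 (u t)) (at t)" if "t \<in> J" for t
    using u(1) that by (simp add: ivp_solution_def)
  define res where "res h t i = imex_residual c P Q R Qhat Rhat F0 F1 u h t i" for h t i

  obtain g where g_bounded: "\<And>i. i < s \<Longrightarrow> uniformly_O T 0 (\<lambda>_ t. g t i)"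
    and g_res: "\<And>i. i < s \<Longrightarrow> uniformly_O T (s + 2) (\<lambda>h t. res h t i - h ^ (s + 1) *\<^sub>R (g t i - mat_act P (g (t - h)) i))"
    using imex_residual_telescopes[OF T J smooth(1) u(2) ode c distinct P Q_mat R S2(1) S1 order range_d range_l]
    unfolding res_def Qhat Rhat by blast
  obtain B where B: "B \<ge> 0"
    "\<forall>\<^sub>F h in at_right 0. \<forall>t\<in>{0..T}. \<forall>i<s. norm (res h t i - h ^ (s + 1) *\<^sub>R (g t i - mat_act P (g (t - h)) i)) \<le> B * h ^ (s + 2)"
    by (rule uniformly_O_common_constant[OF g_res])
  obtain G where G: "G \<ge> 0" "\<forall>\<^sub>F h in at_right (0::real). \<forall>t\<in>{0..T}. \<forall>i<s. norm (g t i) \<le> G * h ^ 0"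
    by (rule uniformly_O_common_constant[OF g_bounded])
  have "uniformly_O T (s + 1) (\<lambda>h t. W h 0 i - u (c $ i * h))" if i: "i < s" for i
  proof -
    have "(\<lambda>h. norm (W h 0 i - u (c $ i * h))) \<in> O[at_right 0](\<lambda>h. h ^ (s + 1))"
      using init i by (simp add: initial_values_of_order_def dim)
    then obtain C where "\<forall>\<^sub>F h in at_right 0. norm (norm (W h 0 i - u (c $ i * h))) \<le> C * norm (h ^ (s + 1))"
      by (auto elim: landau_o.bigE)
    then have "\<forall>\<^sub>F h in at_right 0. \<forall>t\<in>{0..T}. norm (W h 0 i - u (c $ i * h)) \<le> C * h ^ (s + 1)"
      using eventually_pos_at_right_0 by eventually_elim (auto simp: abs_mult)
    then show ?thesis
      by (auto simp: uniformly_O_def)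
  qed
  then obtain C0 where C0: "C0 \<ge> 0"
    "\<forall>\<^sub>F h in at_right 0. \<forall>t\<in>{0..T}. \<forall>i<s. norm (W h 0 i - u (c $ i * h)) \<le> C0 * h ^ (s + 1)"
    by (rule uniformly_O_common_constant[where r = "\<lambda>h t i. W h 0 i - u (c $ i * h)"])
  have u_cont: "continuous_on J u"
    by (rule Ck_on_imp_continuous_on[OF u(2)])
  have "uniformly_O T 0 (\<lambda>h t. u (t + c $ i * h))" for i
    using Taylor_uniformly_O[OF T J, where D = "\<lambda>_. u" and p = 0 and \<alpha> = "c $ i"] u_cont by simp
  then obtain \<rho> where \<rho>: "\<rho> \<ge> 0" "\<forall>\<^sub>F h in at_right 0. \<forall>t\<in>{0..T}. \<forall>i<s. norm (u (t + c $ i * h)) \<le> \<rho> * h ^ 0"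
    by (rule uniformly_O_common_constant[where r = "\<lambda>h t i. u (t + c $ i * h)"])

  have rec: "\<forall>\<^sub>F h in at_right 0. \<forall>n\<ge>1. real n * h \<le> T \<longrightarrow> (\<forall>i<s.
      W h n i = imex_rhs P Q R Qhat Rhat F0 F1 h (W h (n - 1)) (W h n) i)"
    using W unfolding imex_peer_solution_def imex_rhs_def dim by blast
  obtain r where r: "\<forall>\<^sub>F h in at_right 0. \<forall>n. real n * h \<le> T \<longrightarrow> (\<forall>i<s.
      dist (W h n i) (u (real n * h + c $ i * h)) \<le> r)"
    using W unfolding imex_peer_solution_def dim by blast
  have C1: "Ck_on 1 F0 UNIV" "Ck_on 1 F1 UNIV"
    using Ck_on_le smooth by (metis le_add2)+
  obtain M where M: "M \<ge> 0" "\<And>h v w v' w' i. \<lbrakk>0 \<le> h; i < s; \<And>k. k < s \<Longrightarrow> v k \<in> cball 0 (\<rho> + \<bar>r\<bar>)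
        \<and> w k \<in> cball 0 (\<rho> + \<bar>r\<bar>) \<and> v' k \<in> cball 0 (\<rho> + \<bar>r\<bar>) \<and> w' k \<in> cball 0 (\<rho> + \<bar>r\<bar>)\<rbrakk>
      \<Longrightarrow> norm (imex_rhs P Q R Qhat Rhat F0 F1 h v w i - imex_rhs P Q R Qhat Rhat F0 F1 h v' w' i
          - mat_act P (\<lambda>k. v k - v' k) i)
        \<le> h * M * (stage_norm s (\<lambda>k. v k - v' k) + stage_norm s (\<lambda>k. w k - w' k))"
    using imex_rhs_Lipschitz[OF P Q_mat R hats C1 s, of "\<rho> + \<bar>r\<bar>"] by blast
  obtain C h1 where C: "C \<ge> 0" "h1 > 0"
    and stab: "\<And>(x :: nat \<Rightarrow> nat \<Rightarrow> real ^ 'm) h N a b.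
      \<lbrakk>0 < h; h \<le> h1; real N * h \<le> T; a \<ge> 0; b \<ge> 0; stage_norm s (x 0) \<le> a;
       \<And>n i. 1 \<le> n \<Longrightarrow> n \<le> N \<Longrightarrow> i < s \<Longrightarrow>
         norm (x n i - mat_act P (x (n - 1)) i) \<le> h * b + h * M * (stage_norm s (x (n - 1)) + stage_norm s (x n))\<rbrakk>
      \<Longrightarrow> stage_norm s (x N) \<le> C * (a + T * b)"
    using stable_recursion_bound[OF P stable s M(1), where T = T and 'v = "real ^ 'm"] by blast

  \<comment> \<open>\<open>K\<close> collects, in units of \<open>h ^ (s + 1)\<close>: the initial value of the shifted error, at most
    \<open>C0 + G\<close>; the perturbations divided by \<open>h\<close>, at most \<open>B\<close> from the residual and \<open>2 * M * G\<close> from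
    replacing the error by the shifted error inside the Lipschitz terms; and the shift \<open>G\<close> itself.\<close>
  define e where "e h n i = u (real n * h + c $ i * h) - W h n i" for h n i
  define K where "K = C * ((C0 + G) + T * (B + 2 * M * G)) + G"
  have "\<forall>\<^sub>F h in at_right 0. h < h1"
    using C(2) by (intro eventually_at_right_0_I)
  then have bound: "\<forall>\<^sub>F h in at_right 0. h > 0 \<and> (\<forall>n. real n * h \<le> T \<longrightarrow> stage_norm s (e h n) \<le> K * h ^ (s + 1))"
    using rec r B(2) G(2) C0(2) \<rho>(2) eventually_pos_at_right_0
  proof eventually_elim
    case (elim h)
    note h = \<open>h < h1\<close> \<open>h > 0\<close>
    \<comment> \<open>The error with its leading global part removed.\<close>
    define x where "x n i = e h n i - h ^ (s + 1) *\<^sub>R g (real n * h) i" for n i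
    have e_x: "stage_norm s (e h n) \<le> stage_norm s (x n) + G * h ^ (s + 1)" if n: "real n * h \<le> T" for n
    proof -
      have "norm (e h n i) \<le> stage_norm s (x n) + G * h ^ (s + 1)" if i: "i < s" for i
      proof -
        have "norm (g (real n * h) i) \<le> G"
          using elim(5) n i h by auto
        then have "norm (h ^ (s + 1) *\<^sub>R g (real n * h) i) \<le> G * h ^ (s + 1)"
          using h by (simp add: mult_right_mono mult.commute)
        moreover have "norm (x n i) \<le> stage_norm s (x n)"
          by (rule norm_le_stage_norm[OF i])
        moreover have "e h n i = x n i + h ^ (s + 1) *\<^sub>R g (real n * h) i"
          by (simp add: x_def)
        ultimately show ?thesis
          by (metis norm_triangle_mono)
      qed
      then show ?thesis
        using stage_norm_le_iff[OF s] by blast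
    qed
    have x0: "stage_norm s (x 0) \<le> (C0 + G) * h ^ (s + 1)"
    proof -
      have "norm (x 0 i) \<le> (C0 + G) * h ^ (s + 1)" if i: "i < s" for i
      proof -
        have e0: "norm (e h 0 i) \<le> C0 * h ^ (s + 1)"
          using elim(6) T i by (auto simp: e_def norm_minus_commute)
        have g0: "norm (h ^ (s + 1) *\<^sub>R g 0 i) \<le> G * h ^ (s + 1)"
          using elim(5) T i h by (auto simp: mult.commute intro!: mult_left_mono)
        have "x 0 i = e h 0 i - h ^ (s + 1) *\<^sub>R g 0 i"
          by (simp add: x_def)
        then show ?thesis
          unfolding distrib_right using order_trans[OF norm_triangle_ineq4 add_mono[OF e0 g0]] by (simp only:)
      qed
      then show ?thesis
        using stage_norm_le_iff[OF s] by blast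
    qed
    have step: "norm (x n i - mat_act P (x (n - 1)) i)
        \<le> h * ((B + 2 * M * G) * h ^ (s + 1)) + h * M * (stage_norm s (x (n - 1)) + stage_norm s (x n))"
      if n: "1 \<le> n" "real n * h \<le> T" and i: "i < s" for n i
    proof -
      define t where "t = real n * h"
      have t: "t \<in> {0..T}" and t': "real (n - 1) * h = t - h" "real (n - 1) * h \<le> T"
        using n h by (auto simp: t_def of_nat_diff algebra_simps)
      define v where "v k = u (t + (c $ k - 1) * h)" for k
      define w where "w k = u (t + c $ k * h)" for k
      have prev_node: "real (n - 1) * h + c $ k * h = t + (c $ k - 1) * h" for k
        unfolding t'(1) by (simp add: algebra_simps)
      have e_v: "e h (n - 1) = (\<lambda>k. v k - W h (n - 1) k)"
        by (rule ext) (simp only: e_def v_def prev_node)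
      have e_w: "e h n = (\<lambda>k. w k - W h n k)"
        by (auto simp: e_def w_def t_def)
      have in_ball: "v k \<in> cball 0 (\<rho> + \<bar>r\<bar>) \<and> w k \<in> cball 0 (\<rho> + \<bar>r\<bar>)
          \<and> W h (n - 1) k \<in> cball 0 (\<rho> + \<bar>r\<bar>) \<and> W h n k \<in> cball 0 (\<rho> + \<bar>r\<bar>)" if k: "k < s" for k
      proof -
        have "v k = u (real (n - 1) * h + c $ k * h)"
          by (simp only: v_def prev_node)
        moreover have "real (n - 1) * h \<in> {0..T}"
          using t'(2) h(2) by (intro atLeastAtMost_iff[THEN iffD2] conjI mult_nonneg_nonneg) auto
        ultimately have "norm (v k) \<le> \<rho>" "norm (w k) \<le> \<rho>"
          using elim(7) t k by (auto simp: w_def)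
        moreover have "norm (v k - W h (n - 1) k) \<le> r" "norm (w k - W h n k) \<le> r"
          using elim(3) t'(2) n(2) k e_v e_w
          by (auto simp: dist_norm norm_minus_commute e_def fun_eq_iff)
        ultimately show ?thesis
          using norm_triangle_sub[of "W h (n - 1) k" "v k"] norm_triangle_sub[of "W h n k" "w k"]
          by (auto simp: norm_minus_commute)
      qed
      \<comment> \<open>\<open>\<Delta>\<close> is the effect of the error on the terms with \<open>F0\<close> and \<open>F1\<close>, and \<open>\<tau>\<close> is what is left
        of the residual once \<open>g\<close> has been subtracted.\<close>
      define \<Delta> where "\<Delta> = imex_rhs P Q R Qhat Rhat F0 F1 h v w i
          - imex_rhs P Q R Qhat Rhat F0 F1 h (W h (n - 1)) (W h n) i - mat_act P (e h (n - 1)) i"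
      define \<tau> where "\<tau> = res h t i - h ^ (s + 1) *\<^sub>R (g t i - mat_act P (g (t - h)) i)"
      have "e h n i - mat_act P (e h (n - 1)) i = res h t i + \<Delta>"
      proof -
        have "W h n i = imex_rhs P Q R Qhat Rhat F0 F1 h (W h (n - 1)) (W h n) i"
          using elim(2) n i by blast
        moreover have "res h t i = w i - imex_rhs P Q R Qhat Rhat F0 F1 h v w i"
          by (simp add: res_def imex_residual_def v_def[abs_def] w_def[abs_def])
        moreover have "e h n i = w i - W h n i"
          by (simp only: e_w)
        ultimately show ?thesis
          by (simp add: \<Delta>_def)
      qed
      moreover have "mat_act P (x (n - 1)) i = mat_act P (e h (n - 1)) i - h ^ (s + 1) *\<^sub>R mat_act P (g (t - h)) i"
      proof -
        have "x (n - 1) = (\<lambda>k. e h (n - 1) k - h ^ (s + 1) *\<^sub>R g (t - h) k)"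
          by (rule ext) (simp only: x_def t'(1))
        then show ?thesis
          by (simp only: mat_act_diff_right mat_act_scaleR_right)
      qed
      moreover have "x n i = e h n i - h ^ (s + 1) *\<^sub>R g t i"
        by (simp only: x_def t_def)
      ultimately have "x n i - mat_act P (x (n - 1)) i = \<tau> + \<Delta>"
        by (simp add: \<tau>_def algebra_simps)
      then have "norm (x n i - mat_act P (x (n - 1)) i) \<le> norm \<tau> + norm \<Delta>"
        by (simp add: norm_triangle_ineq)
      also have "norm \<tau> \<le> B * h ^ (s + 2)"
        using elim(4) t i unfolding \<tau>_def by blast
      also have "norm \<Delta> \<le> h * M * (stage_norm s (e h (n - 1)) + stage_norm s (e h n))"
        unfolding \<Delta>_def e_v e_w using M(2)[OF _ i in_ball] h by simp
      also have "\<dots> \<le> h * M * ((stage_norm s (x (n - 1)) + G * h ^ (s + 1)) + (stage_norm s (x n) + G * h ^ (s + 1)))"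
        using e_x n(2) t'(2) h M(1) by (intro mult_left_mono add_mono) auto
      finally show ?thesis
        by (simp add: algebra_simps)
    qed
    have "stage_norm s (e h N) \<le> K * h ^ (s + 1)" if N: "real N * h \<le> T" for N
    proof -
      have "stage_norm s (x N) \<le> C * ((C0 + G) * h ^ (s + 1) + T * ((B + 2 * M * G) * h ^ (s + 1)))"
      proof (rule stab[where x = x, OF h(2) _ N _ _ x0])
        fix n i assume n: "1 \<le> n" "n \<le> N" and i: "i < s"
        have "real n * h \<le> real N * h"
          using n h by (intro mult_right_mono) auto
        with N show "norm (x n i - mat_act P (x (n - 1)) i) \<le> h * ((B + 2 * M * G) * h ^ (s + 1))
            + h * M * (stage_norm s (x (n - 1)) + stage_norm s (x n))"
          by (intro step n i) simp
      qed (use h B(1) C0(1) G(1) M(1) in auto)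
      with e_x[OF N] show ?thesis
        by (simp add: K_def algebra_simps)
    qed
    with h show ?case
      by blast
  qed
  \<comment> \<open>The maximum defining the global error is taken over a finite nonempty set, hence attained.\<close>
  have "\<forall>\<^sub>F h in at_right 0. norm (global_error c u T W h) \<le> K * norm (h ^ (s + 1))"
    using bound
  proof eventually_elim
    case (elim h)
    define I where "I = {n. real n * h \<le> T}"
    have "I \<subseteq> {..nat \<lfloor>T / h\<rfloor>}"
      using elim by (auto simp: I_def le_nat_floor pos_le_divide_eq)
    then have "finite I"
      by (rule finite_subset) simp
    moreover have "0 \<in> I"
      using T by (simp add: I_def)
    ultimately have "global_error c u T W h \<in> (\<lambda>n. stage_norm s (e h n)) ` I"
      unfolding global_error_def dim I_def[symmetric] e_def[symmetric] by (intro Max_in) auto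
    then obtain n where n: "real n * h \<le> T" "global_error c u T W h = stage_norm s (e h n)"
      by (auto simp: I_def)
    then show ?case
      using elim stage_norm_nonneg[OF s, of "e h n"] by (simp add: abs_mult)
  qed
  then show ?thesis
    unfolding convergent_of_order_def by (rule bigoI)
qed

end
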